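(* Let $S$ be a centred Catalan set. Then $w_l(S)$ (for positive integers $l$) is given by a polynomial in $l$ of degree $|\lambda(S)/\mu(S)|=\operatorname{area}(\mathbf{M}(S))$ with leading coefficient $\dfrac{f^{\lambda(S)/\mu(S)}}{|\lambda(S)/\mu(S)|!}$.
   Context: A centred Catalan set of size $n$ is an $n$-subset $S$ of $\{-n+1,\dots,n-1\}$ with $|S\cap\{-i,\dots,i\}|\ge i+1$ for all $0\le i\le n-1$. For $S$ of size $n+1$, $\mathbf{M}(S)=(m_1,\dots,m_n)$ with $m_i=|\{-i,i\}\cap S|-1$ is a Motzkin path (steps $(1,m_i)$, staying weakly above the $x$-axis, from $(0,0)$ to $(n,0)$), and $\operatorname{area}(\mathbf{M}(S))$ is the area of the region between this path and the $x$-axis. Write $S=\{s_1,\dots,s_u,0,s_{u+1},\dots,s_n\}$ with $s_1<\dots<s_u<0<s_{u+1}<\dots<s_n$. Define Young diagrams $\lambda(S)=(u+1-s_{u+1},\,u+2-s_{u+2},\dots,n-s_n)'$ (where $'$ denotes the conjugate partition) and $\mu(S)=(-s_1-u,\,-s_2-u+1,\dots,-s_u-1)$ (the $i$-th part being $-s_i-(u+1-i)$); then $\mu(S)\subseteq\lambda(S)$. $f^{\lambda/\mu}$ denotes the number of standard Young tableaux of skew shape $\lambda/\mu$, and $|\lambda/\mu|$ its number of cells. Let $n,l$ be positive integers. An $(n,l)$-AS-trapezoid is an array of $n$ centred rows, the $i$-th row from the bottom having $l+2i-1$ entries from $\{-1,0,1\}$, such that all row sums are $1$, the column sums of the central $l-1$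 columns are $0$, the nonzero entries in every row and in every column alternate in sign, and in every column the first nonzero entry from the top is positive. Label the columns $-n+1,\dots,l+n-1$ from left to right. $\mathcal{S}(A)$ is $\{0\}\cup\{c-1: c\le 0,\ \text{column } c\text{ has positive sum}\}\cup\{c-(l-1): c\ge1,\ \text{column } c\text{ has positive sum}\}$. For a centred Catalan set $S$ of size $n+1$, $w_l(S)$ is the number of $(n,l)$-AS-trapezoids $A$ with $\mathcal{S}(A)=S$. *)

theory Defs
  imports "HOL-Analysis.Analysis" "HOL-Computational_Algebra.Polynomial"
begin

definition centred_catalan_set :: "nat \<Rightarrow> int set \<Rightarrow> bool" where
  "centred_catalan_set n S \<longleftrightarrow>
     S \<subseteq> {- int n + 1..int n - 1} \<and> card S = n \<and>
     (\<forall>i<n. card (S \<inter> {- int i..int i}) \<ge> i + 1)"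


definition motzkin_steps :: "nat \<Rightarrow> int set \<Rightarrow> int list" where
  "motzkin_steps n S = map (\<lambda>i. int (card ({- int i, int i} \<inter> S)) - 1) [1..<n + 1]"

text \<open>
  The path with steps \<open>(1, m)\<close> for \<open>m\<close> in the list, starting in the origin, as the graph of a
  piecewise linear function on \<open>[0, length ms]\<close>: on \<open>[k, k + 1]\<close> it has slope \<open>ms ! k\<close>.
\<close>
definition path_height :: "int list \<Rightarrow> real \<Rightarrow> real" where
  "path_height ms x =
     (let k = nat \<lfloor>x\<rfloor>
      in of_int (sum_list (take k ms)) + (x - real k) * (if k < length ms then of_int (ms ! k) else 0))"

definition path_area :: "int list \<Rightarrow> real" where
  "path_area ms =
     measure lborel {(x, y). 0 \<le> x \<and> x \<le> real (length ms) \<and> 0 \<le> y \<and> y \<le> path_height ms x}"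


text \<open>
  Young diagrams are sets of cells (row, column), both counted from \<open>0\<close>, in English notation.
  Trailing zero parts of the list contribute no cells.
\<close>
definition young_diagram :: "nat list \<Rightarrow> (nat \<times> nat) set" where
  "young_diagram p = {(i, j). i < length p \<and> j < p ! i}"

definition conjugate_diagram :: "(nat \<times> nat) set \<Rightarrow> (nat \<times> nat) set" where
  "conjugate_diagram D = {(i, j). (j, i) \<in> D}"

definition standard_tableaux :: "(nat \<times> nat) set \<Rightarrow> (nat \<times> nat \<Rightarrow> nat) set" where
  "standard_tableaux D =
     {T \<in> extensional D. bij_betw T D {1..card D} \<and>
        (\<forall>i j j'. (i, j) \<in> D \<and> (i, j') \<in> D \<and> j < j' \<longrightarrow> T (i, j) < T (i, j')) \<and>
        (\<forall>i i' j. (i, j) \<in> D \<and> (i', j) \<in> D \<and> i < i' \<longrightarrow> T (i, j) < T (i', j))}"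


text \<open>\<open>nonzero_elem S i\<close> is $s_i$, with $s_1 < \dots < s_n$ the nonzero elements of \<open>S\<close>.\<close>
definition nonzero_elem :: "int set \<Rightarrow> nat \<Rightarrow> int" where
  "nonzero_elem S i = sorted_list_of_set (S - {0}) ! (i - 1)"

definition num_neg :: "int set \<Rightarrow> nat" where
  "num_neg S = card {s \<in> S. s < 0}"

text \<open>
  In the next two definitions \<open>nat\<close> does not truncate if \<open>S\<close> is a centred Catalan set of size
  \<open>n + 1\<close>: the $s_i$ are strictly increasing integers with $s_n \le n$, so $s_i \le i$ for $i > u$ and
  $-s_i \ge u + 1 - i$ for $i \le u$.
\<close>
definition lambda_diagram :: "nat \<Rightarrow> int set \<Rightarrow> (nat \<times> nat) set" where
  "lambda_diagram n S = conjugate_diagram (young_diagram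
     (map (\<lambda>i. nat (int i - nonzero_elem S i)) [num_neg S + 1..<n + 1]))"

definition mu_diagram :: "int set \<Rightarrow> (nat \<times> nat) set" where
  "mu_diagram S = young_diagram
     (map (\<lambda>i. nat (- nonzero_elem S i - (int (num_neg S) + 1 - int i))) [1..<num_neg S + 1])"

definition skew_shape :: "nat \<Rightarrow> int set \<Rightarrow> (nat \<times> nat) set" where
  "skew_shape n S = lambda_diagram n S - mu_diagram S"


text \<open>
  Cells of a trapezoid are pairs (row, column), rows being counted from the bottom starting with
  \<open>1\<close>, and columns being labelled by \<open>1 - n, \<dots>, l + n - 1\<close>. Row \<open>i\<close> has \<open>l + 2 * i - 1\<close> cells;
  the \<open>l - 1\<close> central columns are \<open>1, \<dots>, l - 1\<close>.
\<close>
definition trapezoid_cells :: "nat \<Rightarrow> nat \<Rightarrow> (nat \<times> int) set" where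
  "trapezoid_cells n l = {(i, c). 1 \<le> i \<and> i \<le> n \<and> 1 - int i \<le> c \<and> c \<le> int l + int i - 1}"

definition row_entries :: "nat \<Rightarrow> (nat \<times> int \<Rightarrow> int) \<Rightarrow> nat \<Rightarrow> int list" where
  "row_entries l A i = map (\<lambda>c. A (i, c)) [1 - int i..int l + int i - 1]"

text \<open>The entries of a column from top to bottom.\<close>
definition column_entries :: "nat \<Rightarrow> nat \<Rightarrow> (nat \<times> int \<Rightarrow> int) \<Rightarrow> int \<Rightarrow> int list" where
  "column_entries n l A c =
     map (\<lambda>i. A (i, c)) (filter (\<lambda>i. (i, c) \<in> trapezoid_cells n l) (rev [1..<n + 1]))"

definition nonzero_entries :: "int list \<Rightarrow> int list" where
  "nonzero_entries xs = filter (\<lambda>x. x \<noteq> 0) xs"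

definition alternating :: "int list \<Rightarrow> bool" where
  "alternating xs \<longleftrightarrow> successively (\<lambda>x y. sgn x \<noteq> sgn y) (nonzero_entries xs)"

definition as_trapezoid :: "nat \<Rightarrow> nat \<Rightarrow> (nat \<times> int \<Rightarrow> int) \<Rightarrow> bool" where
  "as_trapezoid n l A \<longleftrightarrow>
     A \<in> trapezoid_cells n l \<rightarrow>\<^sub>E {-1, 0, 1} \<and>
     (\<forall>i\<in>{1..n}. sum_list (row_entries l A i) = 1 \<and> alternating (row_entries l A i)) \<and>
     (\<forall>c\<in>{1..int l - 1}. sum_list (column_entries n l A c) = 0) \<and>
     (\<forall>c\<in>{1 - int n..int l + int n - 1}.
        alternating (column_entries n l A c) \<and>
        (nonzero_entries (column_entries n l A c) \<noteq> [] \<longrightarrow>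
           hd (nonzero_entries (column_entries n l A c)) > 0))"

definition trapezoid_set :: "nat \<Rightarrow> nat \<Rightarrow> (nat \<times> int \<Rightarrow> int) \<Rightarrow> int set" where
  "trapezoid_set n l A =
     {0} \<union>
     {c - 1 | c. 1 - int n \<le> c \<and> c \<le> 0 \<and> sum_list (column_entries n l A c) > 0} \<union>
     {c - (int l - 1) | c. 1 \<le> c \<and> c \<le> int l + int n - 1 \<and> sum_list (column_entries n l A c) > 0}"

definition trapezoid_weight :: "nat \<Rightarrow> nat \<Rightarrow> int set \<Rightarrow> nat" where
  "trapezoid_weight n l S = card {A. as_trapezoid n l A \<and> trapezoid_set n l A = S}"

end

theory Submission
  imports Defs
begin

text \<open>
  In an AS-trapezoid all partial column sums, taken from the top, are 0 or 1. Let $Y_i$ be the set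
  of columns of row $i$ whose partial sum above row $i$ is 1. Row $i$ being alternating with sum 1
  says that $Y_i$ interlaces with $Y_{i-1}$, enlarged by the leftmost (rightmost) column of row $i$
  if $-i \in S$ (if $i \in S$); hence $|Y_i|$ is the height $h_i$ of the Motzkin path. All these
  conditions only depend on the relative order of the columns, so an empty central column may be
  deleted, and $w_l(S) = \sum_k \binom{l-1}{k} N_k$, where $N_k$ counts the families with exactly $k$
  central columns, all of them nonempty. As $\sum_i h_i = N$ is the area, $N_k = 0$ for $k > N$, and
  for $k = N$ every central column lies in exactly one $Y_i$ and every $Y_i$ consists of central
  columns. Writing the elements of $Y_i$ along the $i$-th diagonal of $\lambda/\mu$ then turns
  interlacing into the standardness of a tableau, so $N_N = f^{\lambda/\mu}$.
\<close>

subsection \<open>Alternating sign conditions as conditions on prefix sums\<close>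

text \<open>Consecutive partial column sums differ by one entry, so row i is the indicator of the
  enlarged Y_{i-1} minus that of Y_i. The enlargement occurs because the trapezoid widens upwards:
  the end columns of row i have their bottom cell there, so their partial sum down to row i is the
  whole column sum, which S prescribes.

  Since N_k does not depend on l and binom(l - 1, k) has degree k in l with leading coefficient
  1/k!, degree and leading coefficient follow once N_N is known to be positive.

  Diagonals enter as follows. Let u be the number of negative elements of S. Whether a cell (r, c)
  lies in lambda, and whether it lies in mu, is decided by comparing one element of S with i = u + c
  - r. So diagonal i depends only on u and the elements of S of absolute value at most i, and it has
  h_i cells. Neighbouring cells lie on neighbouring diagonals. Diagonal i + 1 starts above the start
  of diagonal i if -(i + 1) is in S, and to the right of it otherwise. This is the same alternative
  that decides on which side Y_{i+1} and Y_i interlace.\<close>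

lemma alternating_iff_prefix_sums_aux:
  assumes "set xs \<subseteq> {-1, 0, 1}"
  shows "(alternating xs \<and> (nonzero_entries xs \<noteq> [] \<longrightarrow> hd (nonzero_entries xs) > 0) \<longleftrightarrow>
           (\<forall>k. sum_list (take k xs) \<in> {0, 1})) \<and>
         (alternating xs \<and> (nonzero_entries xs \<noteq> [] \<longrightarrow> hd (nonzero_entries xs) < 0) \<longleftrightarrow>
           (\<forall>k. sum_list (take k xs) \<in> {-1, 0}))"
  using assms
\<comment> \<open>The two sign patterns must be proved together: removing a leading 1 or -1 turns
  one into the other and shifts all prefix sums by one.\<close>
proof (induction xs)
  case Nil
  then show ?case by (simp add: alternating_def nonzero_entries_def)
next
  case (Cons x xs)
  have split_take: "(\<forall>k. sum_list (take k (x # xs)) \<in> A) \<longleftrightarrow>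
      0 \<in> A \<and> (\<forall>k. x + sum_list (take k xs) \<in> A)" for A
  proof -
    have "(\<forall>k. Q k) \<longleftrightarrow> Q 0 \<and> (\<forall>k. Q (Suc k))" for Q :: "nat \<Rightarrow> bool"
      by (metis not0_implies_Suc)
    from this[of "\<lambda>k. sum_list (take k (x # xs)) \<in> A"] show ?thesis by simp
  qed
  have step: "nonzero_entries (x # xs) = x # nonzero_entries xs" if "x \<noteq> 0"
    using that by (simp add: nonzero_entries_def)
  have pm: "y = 1 \<or> y = -1" if "y \<in> set (nonzero_entries xs)" for y
    using that Cons.prems by (auto simp: nonzero_entries_def)
  note IH1 = Cons.IH[THEN conjunct1, rule_format]
  note IH2 = Cons.IH[THEN conjunct2, rule_format]
  have sub: "set xs \<subseteq> {-1, 0, 1}" using Cons.prems by simp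
  consider "x = 0" | "x = 1" | "x = -1" using Cons.prems by auto
  then show ?case
  proof cases
    case 1
    then show ?thesis
      using Cons.IH[OF sub] unfolding split_take by (simp add: alternating_def nonzero_entries_def)
  next
    case 2
    have "alternating (x # xs) \<longleftrightarrow>
        alternating xs \<and> (nonzero_entries xs \<noteq> [] \<longrightarrow> hd (nonzero_entries xs) < 0)"
      using 2 pm[of "hd (nonzero_entries xs)"] step
      by (cases "nonzero_entries xs") (auto simp: alternating_def)
    moreover have "hd (nonzero_entries (x # xs)) = 1" "nonzero_entries (x # xs) \<noteq> []"
      using 2 by (auto simp: nonzero_entries_def)
    moreover have "(1 + s \<in> {0, 1}) = (s \<in> {-1, 0})" for s :: int by auto
    moreover have "\<not> (\<forall>k. 1 + sum_list (take k xs) \<in> {-1, 0})"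
      by (auto intro: exI[of _ 0])
    ultimately show ?thesis
      using IH2[OF sub] 2 unfolding split_take by simp
  next
    case 3
    have "alternating (x # xs) \<longleftrightarrow>
        alternating xs \<and> (nonzero_entries xs \<noteq> [] \<longrightarrow> hd (nonzero_entries xs) > 0)"
      using 3 pm[of "hd (nonzero_entries xs)"] step
      by (cases "nonzero_entries xs") (auto simp: alternating_def)
    moreover have "hd (nonzero_entries (x # xs)) = -1" "nonzero_entries (x # xs) \<noteq> []"
      using 3 by (auto simp: nonzero_entries_def)
    moreover have "(-1 + s \<in> {-1, 0}) = (s \<in> {0, 1})" for s :: int by auto
    moreover have "\<not> (\<forall>k. -1 + sum_list (take k xs) \<in> {0, 1})"
      by (auto intro: exI[of _ 0])
    ultimately show ?thesis
      using IH1[OF sub] 3 unfolding split_take by simp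
  qed
qed

lemma alternating_positive_iff_prefix_sums:
  assumes "set xs \<subseteq> {-1, 0, 1}"
  shows "alternating xs \<and> (nonzero_entries xs \<noteq> [] \<longrightarrow> hd (nonzero_entries xs) > 0) \<longleftrightarrow>
           (\<forall>k\<le>length xs. sum_list (take k xs) \<in> {0, 1})"
proof -
  have "(\<forall>k\<le>length xs. sum_list (take k xs) \<in> {0, 1}) \<longleftrightarrow> (\<forall>k. sum_list (take k xs) \<in> {0, 1})"
    by (metis nat_le_linear take_all order_refl)
  then show ?thesis using alternating_iff_prefix_sums_aux[OF assms] by blast
qed

text \<open>A negative first nonzero entry would keep all prefix sums in {-1, 0}, against the total
  1. So rows satisfy the same criterion as columns although their definition does not prescribe the
  first sign.\<close>

lemma alternating_sum_one_iff_prefix_sums: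
  assumes "set xs \<subseteq> {-1, 0, 1}"
  shows "sum_list xs = 1 \<and> alternating xs \<longleftrightarrow>
           sum_list xs = 1 \<and> (\<forall>k\<le>length xs. sum_list (take k xs) \<in> {0, 1})"
proof -
  have "nonzero_entries xs \<noteq> [] \<longrightarrow> hd (nonzero_entries xs) > 0"
    if "sum_list xs = 1" "alternating xs"
  proof (rule ccontr)
    assume "\<not> ?thesis"
    then have "nonzero_entries xs \<noteq> []" and le: "\<not> hd (nonzero_entries xs) > 0" by auto
    then have "hd (nonzero_entries xs) \<in> set (nonzero_entries xs)" by simp
    then have "hd (nonzero_entries xs) \<noteq> 0" unfolding nonzero_entries_def by simp
    with le have "hd (nonzero_entries xs) < 0" by simp
    with that alternating_iff_prefix_sums_aux[OF assms]
    have "\<forall>k. sum_list (take k xs) \<in> {-1, 0}" by blast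
    from this[rule_format, of "length xs"] that show False by simp
  qed
  then show ?thesis using alternating_positive_iff_prefix_sums[OF assms] by blast
qed

lemma take_upto:
  assumes "a + int k \<le> b + 1"
  shows "take k [a..b] = [a..a + int k - 1]"
proof -
  have "[a..b] = [a..a + int k - 1] @ [a + int k..b]"
  proof (cases "a + int k \<le> b")
    case True
    then show ?thesis by (simp add: upto_split1[of a "a + int k" b])
  next
    case False
    with assms have "b = a + int k - 1" by simp
    then show ?thesis by simp
  qed
  moreover have "length [a..a + int k - 1] = k" by simp
  ultimately show ?thesis by simp
qed

lemma row_condition_iff:
  assumes "\<And>c. 1 - int i \<le> c \<Longrightarrow> c \<le> int l + int i - 1 \<Longrightarrow> A (i, c) \<in> {-1, 0, 1 :: int}"
    and "i \<ge> 1"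
  shows "sum_list (row_entries l A i) = 1 \<and> alternating (row_entries l A i) \<longleftrightarrow>
    (\<Sum>c\<in>{1 - int i..int l + int i - 1}. A (i, c)) = 1 \<and>
    (\<forall>x\<in>{1 - int i..int l + int i - 1}. (\<Sum>c\<in>{1 - int i..x}. A (i, c)) \<in> {0, 1})"
proof -
  let ?a = "1 - int i" and ?b = "int l + int i - 1"
  have sub: "set (row_entries l A i) \<subseteq> {-1, 0, 1}"
    using assms(1) unfolding row_entries_def by fastforce
  have len: "length (row_entries l A i) = nat (?b - ?a + 1)"
    by (simp add: row_entries_def)
  have pre: "sum_list (take k (row_entries l A i)) = (\<Sum>c\<in>{?a..?a + int k - 1}. A (i, c))"
    if "k \<le> length (row_entries l A i)" for k
  proof -
    have "take k [?a..?b] = [?a..?a + int k - 1]"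
      by (rule take_upto) (use that len assms(2) in linarith)
    then show ?thesis
      by (simp add: row_entries_def take_map interv_sum_list_conv_sum_set_int)
  qed
  have tot: "sum_list (row_entries l A i) = (\<Sum>c\<in>{?a..?b}. A (i, c))"
    by (simp add: row_entries_def interv_sum_list_conv_sum_set_int)
  have "(\<forall>k\<le>length (row_entries l A i). sum_list (take k (row_entries l A i)) \<in> {0, 1}) \<longleftrightarrow>
      (\<forall>x\<in>{?a..?b}. (\<Sum>c\<in>{?a..x}. A (i, c)) \<in> {0, 1})" (is "?L \<longleftrightarrow> ?R")
  proof
    assume L: ?L
    show ?R
    proof
      fix x assume x: "x \<in> {?a..?b}"
      define k where "k = nat (x - ?a + 1)"
      have "k \<le> length (row_entries l A i)" "?a + int k - 1 = x"
        using x len by (auto simp: k_def)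
      with L pre[of k] show "(\<Sum>c\<in>{?a..x}. A (i, c)) \<in> {0, 1}" by metis
    qed
  next
    assume R: ?R
    show ?L
    proof (intro allI impI)
      fix k assume k: "k \<le> length (row_entries l A i)"
      show "sum_list (take k (row_entries l A i)) \<in> {0, 1}"
      proof (cases "k = 0")
        case False
        then have "?a + int k - 1 \<in> {?a..?b}" using k len by auto
        with R pre[OF k] show ?thesis by simp
      qed simp
    qed
  qed
  then show ?thesis using alternating_sum_one_iff_prefix_sums[OF sub] tot by auto
qed

text \<open>The three arguments of the maxima are the lower bounds on i in the definition of
  \<open>trapezoid_cells\<close>. As the trapezoid widens upwards, a column is exactly the interval
  of rows from here to n.\<close>

definition lowest_row :: "nat \<Rightarrow> int \<Rightarrow> nat" where
  "lowest_row l c = nat (max 1 (max (1 - c) (c - int l + 1)))"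

lemma trapezoid_cells_iff_lowest_row:
  "(i, c) \<in> trapezoid_cells n l \<longleftrightarrow> lowest_row l c \<le> i \<and> i \<le> n"
  by (auto simp: trapezoid_cells_def lowest_row_def)

lemma filter_trapezoid_column:
  "filter (\<lambda>i. (i, c) \<in> trapezoid_cells n l) (rev [1..<n + 1]) = rev [lowest_row l c..<n + 1]"
proof -
  have "lowest_row l c \<ge> 1" by (simp add: lowest_row_def)
  then have "filter (\<lambda>i. lowest_row l c \<le> i \<and> i \<le> m) [1..<m + 1] = [lowest_row l c..<m + 1]" for m
  proof (induction m)
    case (Suc m)
    have "filter (\<lambda>i. lowest_row l c \<le> i \<and> i \<le> Suc m) [1..<m + 1]
        = filter (\<lambda>i. lowest_row l c \<le> i \<and> i \<le> m) [1..<m + 1]"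
      by (rule filter_cong) auto
    with Suc show ?case by auto
  qed auto
  then show ?thesis
    by (simp add: trapezoid_cells_iff_lowest_row rev_filter[symmetric])
qed

lemma take_rev_upt:
  assumes "a + k \<le> b"
  shows "take k (rev [a..<b]) = rev [b - k..<b]"
  using assms by (simp add: take_rev)

lemma column_sum:
  "sum_list (column_entries n l A c) = (\<Sum>i\<in>{lowest_row l c..n}. A (i, c))"
proof -
  have "sum_list (column_entries n l A c) = sum_list (map (\<lambda>i. A (i, c)) [lowest_row l c..<n + 1])"
    by (simp only: column_entries_def filter_trapezoid_column rev_map[symmetric] sum_list_rev)
  also have "\<dots> = (\<Sum>i\<in>{lowest_row l c..n}. A (i, c))"
    by (simp only: interv_sum_list_conv_sum_set_nat set_upt atLeastLessThanSuc_atLeastAtMost Suc_eq_plus1[symmetric])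
  finally show ?thesis .
qed

text \<open>The first k entries from the top are those in the rows above j = n - k. The bound
  \<open>lowest_row l c \<le> Suc j\<close> keeps this sum inside the column, and equality gives the
  total column sum.\<close>

lemma column_condition_iff:
  assumes "\<And>i. lowest_row l c \<le> i \<Longrightarrow> i \<le> n \<Longrightarrow> A (i, c) \<in> {-1, 0, 1 :: int}"
    and "lowest_row l c \<le> n"
  shows "alternating (column_entries n l A c) \<and>
        (nonzero_entries (column_entries n l A c) \<noteq> [] \<longrightarrow>
           hd (nonzero_entries (column_entries n l A c)) > 0) \<longleftrightarrow>
    (\<forall>j\<le>n. lowest_row l c \<le> Suc j \<longrightarrow> (\<Sum>i\<in>{j<..n}. A (i, c)) \<in> {0, 1})"
proof -
  let ?m = "lowest_row l c"
  let ?xs = "column_entries n l A c"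
  have xs: "?xs = map (\<lambda>i. A (i, c)) (rev [?m..<n + 1])"
    by (simp only: column_entries_def filter_trapezoid_column)
  have sub: "set ?xs \<subseteq> {-1, 0, 1}"
    using assms(1) unfolding xs by fastforce
  have len: "length ?xs = n + 1 - ?m" using assms(2) unfolding xs by (simp add: Suc_diff_le)
  have pre: "sum_list (take k ?xs) = (\<Sum>i\<in>{n - k<..n}. A (i, c))" if "k \<le> n + 1 - ?m" "k \<le> n" for k
  proof -
    have "take k ?xs = rev (map (\<lambda>i. A (i, c)) [n + 1 - k..<n + 1])"
      using that assms(2) unfolding xs take_map by (subst take_rev_upt) (auto simp: rev_map)
    then have "sum_list (take k ?xs) = (\<Sum>i\<in>{n + 1 - k..<n + 1}. A (i, c))"
      by (simp only: sum_list_rev interv_sum_list_conv_sum_set_nat set_upt)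
    also have "{n + 1 - k..<n + 1} = {n - k<..n}" using that by auto
    finally show ?thesis .
  qed
  have m1: "?m \<ge> 1" by (simp add: lowest_row_def)
  have "(\<forall>k\<le>length ?xs. sum_list (take k ?xs) \<in> {0, 1}) \<longleftrightarrow>
     (\<forall>j\<le>n. ?m \<le> Suc j \<longrightarrow> (\<Sum>i\<in>{j<..n}. A (i, c)) \<in> {0, 1})" (is "?L \<longleftrightarrow> ?R")
  proof
    assume L: ?L
    show ?R
    proof (intro allI impI)
      fix j assume "j \<le> n" "?m \<le> Suc j"
      then have "n - j \<le> n + 1 - ?m" "n - j \<le> n" "n - (n - j) = j" by auto
      with L pre[of "n - j"] len show "(\<Sum>i\<in>{j<..n}. A (i, c)) \<in> {0, 1}" by metis
    qed
  next
    assume R: ?R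
    show ?L
    proof (intro allI impI)
      fix k assume "k \<le> length ?xs"
      then have k: "k \<le> n + 1 - ?m" "k \<le> n" using len m1 by auto
      then have "?m \<le> Suc (n - k)" using assms(2) m1 by linarith
      with R pre[OF k] show "sum_list (take k ?xs) \<in> {0, 1}" by simp
    qed
  qed
  then show ?thesis using alternating_positive_iff_prefix_sums[OF sub] by simp
qed

subsection \<open>Trapezoids as interlacing families of column sets\<close>

locale catalan_set =
  fixes n :: nat and S :: "int set"
  assumes catalan: "centred_catalan_set (n + 1) S"
begin

section \<open>Elements of the Catalan set and heights of the Motzkin path\<close>

lemma finite_S: "finite S"
  using catalan by (auto simp: centred_catalan_set_def intro: finite_subset)

lemma S_subset: "S \<subseteq> {- int n..int n}"
  using catalan by (auto simp: centred_catalan_set_def)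

lemma zero_in_S: "0 \<in> S"
proof -
  have "card (S \<inter> {- int 0..int 0}) \<ge> 0 + 1"
    using catalan unfolding centred_catalan_set_def by (metis zero_less_Suc Suc_eq_plus1)
  then have "S \<inter> {0} \<noteq> {}" by (metis card.empty add_0 not_one_le_zero of_nat_0 minus_zero atLeastAtMost_singleton)
  then show ?thesis by simp
qed

definition npos :: "nat \<Rightarrow> nat" where
  "npos i = card {s \<in> S. 0 < s \<and> s \<le> int i}"

definition nneg :: "nat \<Rightarrow> nat" where
  "nneg i = card {s \<in> S. - int i \<le> s \<and> s < 0}"

text \<open>Summing m_1, ..., m_i gives this number. The subtraction is exact for i \<le> n: that is
  the Catalan condition, see \<open>npos_nneg_ge\<close>.\<close>

definition height :: "nat \<Rightarrow> nat" where
  "height i = npos i + nneg i - i"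

lemma npos_0 [simp]: "npos 0 = 0" and nneg_0 [simp]: "nneg 0 = 0"
  by (auto simp: npos_def nneg_def)

lemma npos_Suc: "npos (Suc i) = npos i + of_bool (int (Suc i) \<in> S)"
proof -
  have "{s \<in> S. 0 < s \<and> s \<le> int (Suc i)} =
      {s \<in> S. 0 < s \<and> s \<le> int i} \<union> (if int (Suc i) \<in> S then {int (Suc i)} else {})"
    by (auto simp: order_le_less)
  then show ?thesis unfolding npos_def using finite_S by (simp add: card_insert_if)
qed

lemma nneg_Suc: "nneg (Suc i) = nneg i + of_bool (- int (Suc i) \<in> S)"
proof -
  have "{s \<in> S. - int (Suc i) \<le> s \<and> s < 0} =
      {s \<in> S. - int i \<le> s \<and> s < 0} \<union> (if - int (Suc i) \<in> S then {- int (Suc i)} else {})"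
    by (auto simp: order_le_less)
  then show ?thesis unfolding nneg_def using finite_S by (simp add: card_insert_if)
qed

lemma npos_mono: "i \<le> j \<Longrightarrow> npos i \<le> npos j"
  by (induction rule: dec_induct) (auto simp: npos_Suc)

lemma nneg_mono: "i \<le> j \<Longrightarrow> nneg i \<le> nneg j"
  by (induction rule: dec_induct) (auto simp: nneg_Suc)

lemma npos_le: "npos i \<le> i"
  by (induction i) (auto simp: npos_Suc)

lemma nneg_le: "nneg i \<le> i"
  by (induction i) (auto simp: nneg_Suc)

lemma card_S_inter: "card (S \<inter> {- int i..int i}) = npos i + nneg i + 1"
proof -
  have eq: "S \<inter> {- int i..int i} =
      insert 0 ({s \<in> S. 0 < s \<and> s \<le> int i} \<union> {s \<in> S. - int i \<le> s \<and> s < 0})"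
    using zero_in_S by auto
  have "card ({s \<in> S. 0 < s \<and> s \<le> int i} \<union> {s \<in> S. - int i \<le> s \<and> s < 0}) = npos i + nneg i"
    unfolding npos_def nneg_def by (rule card_Un_disjoint) (use finite_S in auto)
  then show ?thesis unfolding eq using finite_S by (subst card_insert_disjoint) auto
qed

lemma npos_nneg_ge: "i \<le> n \<Longrightarrow> i \<le> npos i + nneg i"
  using catalan card_S_inter[of i] by (auto simp: centred_catalan_set_def less_Suc_eq_le)

lemma npos_nneg_n: "npos n + nneg n = n"
proof -
  have "S \<inter> {- int n..int n} = S" using S_subset by auto
  then show ?thesis using card_S_inter[of n] catalan by (simp add: centred_catalan_set_def)
qed

lemma height_add: "i \<le> n \<Longrightarrow> height i + i = npos i + nneg i"
  using npos_nneg_ge[of i] by (simp add: height_def)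

lemma height_0 [simp]: "height 0 = 0" by (simp add: height_def)

lemma height_n [simp]: "height n = 0" by (simp add: height_def npos_nneg_n)

lemma height_Suc:
  "i < n \<Longrightarrow> height (Suc i) + 1 =
     height i + of_bool (int (Suc i) \<in> S) + of_bool (- int (Suc i) \<in> S)"
  using height_add[of i] height_add[of "Suc i"] npos_Suc[of i] nneg_Suc[of i] by simp

text \<open>Row n is left out since nothing lies above it, so that Y_n is empty; Y_0 is empty as
  well, matching the height 0 at both ends of the path.\<close>

definition pattern_cells :: "nat \<Rightarrow> (nat \<times> int) set" where
  "pattern_cells l = {(i, c). 1 \<le> i \<and> i < n \<and> 1 - int i \<le> c \<and> c \<le> int l + int i - 1}"

text \<open>Interlacing is expressed through these counts only. They see nothing but the relative
  order of columns, which later allows relabelling them.\<close>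

definition count_le :: "(nat \<times> int) set \<Rightarrow> nat \<Rightarrow> int \<Rightarrow> nat" where
  "count_le Y i x = card {c. (i, c) \<in> Y \<and> c \<le> x}"

text \<open>
  The difference \<open>nneg (Suc i) - nneg i\<close> is 1 if \<open>- (i + 1) \<in> S\<close> and 0 otherwise, so this says that all
  row prefix sums are 0 or 1, freed from subtraction.
\<close>
definition interlacing :: "(nat \<times> int) set \<Rightarrow> bool" where
  "interlacing Y \<longleftrightarrow> (\<forall>i<n. \<forall>x.
     count_le Y (Suc i) x + nneg i \<le> count_le Y i x + nneg (Suc i) \<and>
     count_le Y i x + nneg (Suc i) \<le> count_le Y (Suc i) x + nneg i + 1)"

text \<open>The cardinalities encode that every row sums to 1 (via \<open>height_Suc\<close>), the
  interlacing that the prefix sums of rows are 0 or 1.\<close>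

definition patterns :: "nat \<Rightarrow> (nat \<times> int) set set" where
  "patterns l = {Y. Y \<subseteq> pattern_cells l \<and> (\<forall>i\<le>n. card {c. (i, c) \<in> Y} = height i) \<and> interlacing Y}"

lemma finite_pattern_cells: "finite (pattern_cells l)"
proof -
  have "pattern_cells l \<subseteq> {..n} \<times> {- int n..int l + int n}"
    by (auto simp: pattern_cells_def)
  then show ?thesis by (rule finite_subset) simp
qed

lemma finite_patterns: "finite (patterns l)"
proof -
  have "patterns l \<subseteq> Pow (pattern_cells l)" by (auto simp: patterns_def)
  then show ?thesis using finite_pattern_cells by (simp add: finite_subset)
qed

lemma finite_row: "Y \<subseteq> pattern_cells l \<Longrightarrow> finite {c. (i, c) \<in> Y}"
  by (rule finite_subset[of _ "snd ` pattern_cells l"]) (force simp: finite_pattern_cells)+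

text \<open>
  The columns in which the partial sum over the rows \<open>i, \<dots>, n\<close> is 1, given those (\<open>Y\<close>) for the rows
  strictly above.
\<close>
definition above :: "nat \<Rightarrow> (nat \<times> int) set \<Rightarrow> nat \<Rightarrow> int \<Rightarrow> bool" where
  "above l Y i c \<longleftrightarrow> (i - 1, c) \<in> Y \<or> (c = 1 - int i \<and> - int i \<in> S) \<or> (c = int l + int i - 1 \<and> int i \<in> S)"

text \<open>An entry is the partial column sum down to its row minus the partial column sum strictly
  above it.\<close>

definition pattern_array :: "nat \<Rightarrow> (nat \<times> int) set \<Rightarrow> nat \<times> int \<Rightarrow> int" where
  "pattern_array l Y = (\<lambda>(i, c)\<in>trapezoid_cells n l. of_bool (above l Y i c) - of_bool ((i, c) \<in> Y))"

lemma pattern_array_row_sum: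
  assumes Y: "Y \<subseteq> pattern_cells l" and l: "l \<ge> 1" and i: "i < n"
    and x: "x \<in> {- int i..int l + int i}"
  shows "(\<Sum>c\<in>{- int i..x}. pattern_array l Y (Suc i, c)) =
    of_bool (- int (Suc i) \<in> S) + int (count_le Y i x) +
    of_bool (x = int l + int i \<and> int (Suc i) \<in> S) - int (count_le Y (Suc i) x)"
proof -
  let ?I = "{- int i..x}"
  have sumb: "(\<Sum>c\<in>?I. of_bool (P c)) = int (card {c \<in> ?I. P c})" for P
    by (simp add: Int_def)
  have "(\<Sum>c\<in>?I. pattern_array l Y (Suc i, c)) =
     (\<Sum>c\<in>?I. (of_bool ((i, c) \<in> Y) + of_bool (c = - int i \<and> - int (Suc i) \<in> S)
        + of_bool (c = int l + int i \<and> int (Suc i) \<in> S)) - of_bool ((Suc i, c) \<in> Y))"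
  proof (rule sum.cong)
    fix c assume c: "c \<in> ?I"
    then have "(Suc i, c) \<in> trapezoid_cells n l"
      using x i by (auto simp: trapezoid_cells_def)
    \<comment> \<open>The end columns of row i + 1 do not occur in row i, and they differ because l
      \<ge> 1. So the three cases of \<open>above\<close> exclude each other and its indicator is
      the sum of their indicators.\<close>
    moreover have "(i, c) \<in> Y \<Longrightarrow> c \<noteq> - int i \<and> c \<noteq> int l + int i"
      using Y by (auto simp: pattern_cells_def)
    ultimately show "pattern_array l Y (Suc i, c) = (of_bool ((i, c) \<in> Y) +
        of_bool (c = - int i \<and> - int (Suc i) \<in> S)
        + of_bool (c = int l + int i \<and> int (Suc i) \<in> S)) - of_bool ((Suc i, c) \<in> Y)"
      using l by (auto simp: pattern_array_def above_def)
  qed simp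
  also have "\<dots> = int (card {c \<in> ?I. (i, c) \<in> Y}) + int (card {c \<in> ?I. c = - int i \<and> - int (Suc i) \<in> S})
      + int (card {c \<in> ?I. c = int l + int i \<and> int (Suc i) \<in> S}) - int (card {c \<in> ?I. (Suc i, c) \<in> Y})"
    by (simp only: sum.distrib sum_subtractf sumb)
  also have "{c \<in> ?I. (i, c) \<in> Y} = {c. (i, c) \<in> Y \<and> c \<le> x}"
    using Y by (auto simp: pattern_cells_def)
  also have "{c \<in> ?I. (Suc i, c) \<in> Y} = {c. (Suc i, c) \<in> Y \<and> c \<le> x}"
    using Y by (auto simp: pattern_cells_def)
  also have "{c \<in> ?I. c = - int i \<and> - int (Suc i) \<in> S} = (if - int (Suc i) \<in> S then {- int i} else {})"
    using x by auto
  also have "{c \<in> ?I. c = int l + int i \<and> int (Suc i) \<in> S} =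
      (if x = int l + int i \<and> int (Suc i) \<in> S then {x} else {})"
    using x by auto
  finally show ?thesis by (simp add: count_le_def)
qed

text \<open>The sum telescopes from the top, where \<open>Y\<close> has no cells in row n.\<close>

lemma pattern_array_column_sum:
  assumes Y: "Y \<subseteq> pattern_cells l" and j: "j < n" and c: "lowest_row l c \<le> Suc j"
  shows "(\<Sum>i\<in>{j<..n}. pattern_array l Y (i, c)) = of_bool (above l Y (Suc j) c)"
proof -
  define m where "m = n - 1"
  have n: "n = Suc m" using j by (simp add: m_def)
  have top: "(n, c) \<notin> Y" using Y by (auto simp: pattern_cells_def)
  have "j \<le> m" using j n by simp
  then show ?thesis using c
  proof (induction rule: inc_induct)
    case base
    have "{m<..n} = {n}" using n by auto
    moreover have "(n, c) \<in> trapezoid_cells n l"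
      using base n by (simp add: trapezoid_cells_iff_lowest_row)
    ultimately show ?case using top unfolding n[symmetric] by (simp add: pattern_array_def)
  next
    case (step j)
    have "{j<..n} = insert (Suc j) {Suc j<..n}" using step n by auto
    moreover have "(Suc j, c) \<in> trapezoid_cells n l"
      using step n by (simp add: trapezoid_cells_iff_lowest_row)
    \<comment> \<open>Column c already contains a cell in row j + 1, so it is not an end column of
      row j + 2.\<close>
    moreover have "above l Y (Suc (Suc j)) c \<longleftrightarrow> (Suc j, c) \<in> Y"
      using step.prems by (auto simp: above_def lowest_row_def)
    ultimately show ?case using step by (simp add: pattern_array_def)
  qed
qed

text \<open>At the bottom cell of a column \<open>above\<close> describes the whole column sum. No
  pattern cell lies below it, so only the two end cases of \<open>above\<close> can apply.\<close>

lemma above_lowest_row: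
  assumes Y: "Y \<subseteq> pattern_cells l" and l: "l \<ge> 1"
  shows "above l Y (lowest_row l c) c \<longleftrightarrow>
     (c \<le> 0 \<and> c - 1 \<in> S) \<or> (c \<ge> int l \<and> c - (int l - 1) \<in> S)"
proof -
  have "(lowest_row l c - 1, c) \<notin> pattern_cells l"
    by (auto simp: pattern_cells_def lowest_row_def max_def split: if_splits)
  then have 1: "(lowest_row l c - 1, c) \<notin> Y" using Y by blast
  consider "c \<le> 0" | "c \<ge> int l" | "0 < c" "c < int l" by linarith
  then show ?thesis
  proof cases
    case 1
    then have "int (lowest_row l c) = 1 - c" by (simp add: lowest_row_def)
    then show ?thesis using 1 l \<open>(lowest_row l c - 1, c) \<notin> Y\<close> by (auto simp: above_def)
  next
    case 2
    then have "int (lowest_row l c) = c - (int l - 1)" using l by (simp add: lowest_row_def)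
    then show ?thesis using 2 l \<open>(lowest_row l c - 1, c) \<notin> Y\<close>
      by (auto simp: above_def)
  next
    case 3
    then have "int (lowest_row l c) = 1" by (simp add: lowest_row_def)
    then show ?thesis using 3 l \<open>(lowest_row l c - 1, c) \<notin> Y\<close> by (auto simp: above_def)
  qed
qed

lemma count_le_all:
  assumes "Y \<subseteq> pattern_cells l" "int l + int i \<le> x + 1"
  shows "count_le Y i x = card {c. (i, c) \<in> Y}"
  unfolding count_le_def by (rule arg_cong[of _ _ card]) (use assms in \<open>auto simp: pattern_cells_def\<close>)

section \<open>The bijection between patterns and trapezoids\<close>

lemma trapezoid_columns:
  "c \<in> {1 - int n..int l + int n - 1} \<longleftrightarrow> lowest_row l c \<le> n" if "n \<ge> 1"
  using that by (auto simp: lowest_row_def)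

text \<open>The shifts send the columns c \<le> 0 to negative numbers and the columns c \<ge> l to
  positive ones, so each nonzero element of the set comes from a single outer column. Central
  columns would fall on numbers \<le> 0 under the second shift; their zero sums prevent
  this.\<close>

lemma trapezoid_set_eq_iff:
  "trapezoid_set n l A = S \<longleftrightarrow>
     (\<forall>c\<in>{1 - int n..0}. sum_list (column_entries n l A c) > 0 \<longleftrightarrow> c - 1 \<in> S) \<and>
     (\<forall>c\<in>{int l..int l + int n - 1}. sum_list (column_entries n l A c) > 0 \<longleftrightarrow> c - (int l - 1) \<in> S)"
  if central: "\<And>c. 1 \<le> c \<Longrightarrow> c \<le> int l - 1 \<Longrightarrow> sum_list (column_entries n l A c) = 0" and "l \<ge> 1"
proof -
  let ?pos = "\<lambda>c. sum_list (column_entries n l A c) > 0"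
  have neg_mem: "s \<in> trapezoid_set n l A \<longleftrightarrow> - int n \<le> s \<and> ?pos (s + 1)" if "s < 0" for s
    using that central by (force simp: trapezoid_set_def)
  have pos_mem: "s \<in> trapezoid_set n l A \<longleftrightarrow> s \<le> int n \<and> ?pos (s + (int l - 1))" if "s > 0" for s
    using that \<open>l \<ge> 1\<close> by (auto simp: trapezoid_set_def intro: exI[of _ "s + (int l - 1)"])
  have zero: "0 \<in> trapezoid_set n l A" by (simp add: trapezoid_set_def)
  have "trapezoid_set n l A = S \<longleftrightarrow> (\<forall>s. s \<in> trapezoid_set n l A \<longleftrightarrow> s \<in> S)" by auto
  also have "\<dots> \<longleftrightarrow> (\<forall>s<0. s \<in> trapezoid_set n l A \<longleftrightarrow> s \<in> S) \<and> (\<forall>s>0. s \<in> trapezoid_set n l A \<longleftrightarrow> s \<in> S)"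
    using zero zero_in_S by (metis linorder_neqE)
  also have "(\<forall>s<0. s \<in> trapezoid_set n l A \<longleftrightarrow> s \<in> S) \<longleftrightarrow>
      (\<forall>c\<in>{1 - int n..0}. ?pos c \<longleftrightarrow> c - 1 \<in> S)"
  proof safe
    fix c assume H: "\<forall>s<0. (s \<in> trapezoid_set n l A) = (s \<in> S)" and c: "c \<in> {1 - int n..0}"
    have "(c - 1 \<in> trapezoid_set n l A) = (c - 1 \<in> S)" using H c by auto
    then show "?pos c \<Longrightarrow> c - 1 \<in> S" "c - 1 \<in> S \<Longrightarrow> ?pos c"
      using neg_mem[of "c - 1"] c by auto
  next
    fix s :: int assume H: "\<forall>c\<in>{1 - int n..0}. ?pos c = (c - 1 \<in> S)" and s: "s < 0"
    have "- int n \<le> s \<Longrightarrow> ?pos (s + 1) = (s \<in> S)" using H[rule_format, of "s + 1"] s by auto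
    then show "s \<in> trapezoid_set n l A \<Longrightarrow> s \<in> S" "s \<in> S \<Longrightarrow> s \<in> trapezoid_set n l A"
      using neg_mem[OF s] S_subset by auto
  qed
  also have "(\<forall>s>0. s \<in> trapezoid_set n l A \<longleftrightarrow> s \<in> S) \<longleftrightarrow>
      (\<forall>c\<in>{int l..int l + int n - 1}. ?pos c \<longleftrightarrow> c - (int l - 1) \<in> S)"
  proof safe
    fix c assume H: "\<forall>s>0. (s \<in> trapezoid_set n l A) = (s \<in> S)" and c: "c \<in> {int l..int l + int n - 1}"
    have "(c - (int l - 1) \<in> trapezoid_set n l A) = (c - (int l - 1) \<in> S)" using H c by auto
    then show "?pos c \<Longrightarrow> c - (int l - 1) \<in> S" "c - (int l - 1) \<in> S \<Longrightarrow> ?pos c"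
      using pos_mem[of "c - (int l - 1)"] c by auto
  next
    fix s :: int assume H: "\<forall>c\<in>{int l..int l + int n - 1}. ?pos c = (c - (int l - 1) \<in> S)" and s: "s > 0"
    have "s \<le> int n \<Longrightarrow> ?pos (s + (int l - 1)) = (s \<in> S)"
      using H[rule_format, of "s + (int l - 1)"] s by auto
    then show "s \<in> trapezoid_set n l A \<Longrightarrow> s \<in> S" "s \<in> S \<Longrightarrow> s \<in> trapezoid_set n l A"
      using pos_mem[OF s] S_subset by auto
  qed
  finally show ?thesis .
qed

lemma column_sum_eq_partial:
  "sum_list (column_entries n l A c) = (\<Sum>i\<in>{lowest_row l c - 1<..n}. A (i, c))"
proof -
  have "{lowest_row l c..n} = {lowest_row l c - 1<..n}" by (auto simp: lowest_row_def)
  then show ?thesis by (simp add: column_sum)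
qed

lemma pattern_array_column_total:
  assumes "Y \<subseteq> pattern_cells l" "l \<ge> 1" "lowest_row l c \<le> n"
  shows "sum_list (column_entries n l (pattern_array l Y) c) =
    of_bool ((c \<le> 0 \<and> c - 1 \<in> S) \<or> (c \<ge> int l \<and> c - (int l - 1) \<in> S))"
proof -
  have "lowest_row l c \<ge> 1" by (simp add: lowest_row_def)
  then show ?thesis
    using pattern_array_column_sum[of Y l "lowest_row l c - 1" c] above_lowest_row[of Y l c] assms
    by (simp add: column_sum_eq_partial)
qed

lemma pattern_array_as_trapezoid:
  assumes Y: "Y \<in> patterns l" and l: "l \<ge> 1" and n: "n \<ge> 1"
  shows "as_trapezoid n l (pattern_array l Y)" "trapezoid_set n l (pattern_array l Y) = S"
proof -
  let ?A = "pattern_array l Y"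
  have sub: "Y \<subseteq> pattern_cells l" and cards: "\<And>i. i \<le> n \<Longrightarrow> card {c. (i, c) \<in> Y} = height i"
    and il: "interlacing Y"
    using Y by (auto simp: patterns_def)
  have fn: "?A \<in> trapezoid_cells n l \<rightarrow>\<^sub>E {-1, 0, 1}"
    by (auto simp: pattern_array_def of_bool_def split: if_splits)
  have rows: "sum_list (row_entries l ?A i) = 1 \<and> alternating (row_entries l ?A i)" if i: "i \<in> {1..n}" for i
  proof -
    obtain k where k: "i = Suc k" "k < n" using i by (cases i) auto
    have eqs: "1 - int (Suc k) = - int k" "int l + int (Suc k) - 1 = int l + int k" by auto
    have total: "(\<Sum>c\<in>{- int k..int l + int k}. ?A (Suc k, c)) = 1"
    proof -
      have "count_le Y k (int l + int k) = height k"
        using count_le_all[OF sub, of k "int l + int k"] cards k by simp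
      moreover have "count_le Y (Suc k) (int l + int k) = height (Suc k)"
        using count_le_all[OF sub, of "Suc k" "int l + int k"] cards k by simp
      ultimately show ?thesis
        using pattern_array_row_sum[OF sub l k(2), of "int l + int k"] height_Suc[OF k(2)]
        by (simp add: of_bool_def split: if_splits)
    qed
    have "(\<Sum>c\<in>{- int k..x}. ?A (Suc k, c)) \<in> {0, 1}" if x: "x \<in> {- int k..int l + int k}" for x
    \<comment> \<open>Before the right end the prefix sum has no term for the right end column, and
      interlacing is exactly the bound. At the right end it is the full row sum.\<close>
    proof (cases "x = int l + int k")
      case True
      then show ?thesis using total by simp
    next
      case False
      have "count_le Y (Suc k) x + nneg k \<le> count_le Y k x + nneg (Suc k)"
        "count_le Y k x + nneg (Suc k) \<le> count_le Y (Suc k) x + nneg k + 1"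
        using il k by (auto simp: interlacing_def)
      then show ?thesis
        using pattern_array_row_sum[OF sub l k(2) x] False nneg_Suc[of k] by auto
    qed
    moreover have "?A (Suc k, c) \<in> {-1, 0, 1}" if "- int k \<le> c" "c \<le> int l + int k" for c
    proof -
      have "(Suc k, c) \<in> trapezoid_cells n l" using that k by (auto simp: trapezoid_cells_def)
      then show ?thesis using fn by (rule PiE_mem[rotated])
    qed
    ultimately show ?thesis using total unfolding k(1)
      by (subst row_condition_iff) (unfold eqs, auto)
  qed
  have low: "lowest_row l c \<le> n" if "c \<in> {1 - int n..int l + int n - 1}" for c
    using that trapezoid_columns[OF n] by blast
  have cols: "alternating (column_entries n l ?A c) \<and>
        (nonzero_entries (column_entries n l ?A c) \<noteq> [] \<longrightarrow>
           hd (nonzero_entries (column_entries n l ?A c)) > 0)"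
    if c: "c \<in> {1 - int n..int l + int n - 1}" for c
  proof (subst column_condition_iff)
    show "?A (i, c) \<in> {-1, 0, 1}" if "lowest_row l c \<le> i" "i \<le> n" for i
      using PiE_mem[OF fn, of "(i, c)"] that by (simp add: trapezoid_cells_iff_lowest_row)
    show "lowest_row l c \<le> n" using low[OF c] .
    show "\<forall>j\<le>n. lowest_row l c \<le> Suc j \<longrightarrow> (\<Sum>i\<in>{j<..n}. ?A (i, c)) \<in> {0, 1}"
    proof (intro allI impI)
      fix j assume "j \<le> n" "lowest_row l c \<le> Suc j"
      then show "(\<Sum>i\<in>{j<..n}. ?A (i, c)) \<in> {0, 1}"
        using pattern_array_column_sum[OF sub, of j c] by (cases "j = n") auto
    qed
  qed
  have central: "sum_list (column_entries n l ?A c) = 0" if "1 \<le> c" "c \<le> int l - 1" for c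
    using pattern_array_column_total[OF sub l low[of c]] that n by auto
  show "as_trapezoid n l ?A"
    unfolding as_trapezoid_def using fn rows cols central by auto
  have "sum_list (column_entries n l ?A c) > 0 \<longleftrightarrow> c - 1 \<in> S" if "c \<in> {1 - int n..0}" for c
    using pattern_array_column_total[OF sub l low[of c]] that l by auto
  moreover have "sum_list (column_entries n l ?A c) > 0 \<longleftrightarrow> c - (int l - 1) \<in> S"
    if "c \<in> {int l..int l + int n - 1}" for c
    using pattern_array_column_total[OF sub l low[of c]] that l n by auto
  ultimately show "trapezoid_set n l ?A = S"
    using trapezoid_set_eq_iff[OF central l] by blast
qed

lemma as_trapezoid_imp_pattern_array:
  assumes A: "as_trapezoid n l A" and SA: "trapezoid_set n l A = S" and l: "l \<ge> 1" and n: "n \<ge> 1"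
  shows "\<exists>Y\<in>patterns l. A = pattern_array l Y"
proof -
  define C where "C j c = (\<Sum>i\<in>{j<..n}. A (i, c))" for j c
  \<comment> \<open>The family is forced: it records where the sum strictly above the cell is
    1.\<close>
  define Y where "Y = {(i, c). (i, c) \<in> pattern_cells l \<and> C i c = 1}"
  have sub: "Y \<subseteq> pattern_cells l" by (auto simp: Y_def)
  have fn: "A \<in> trapezoid_cells n l \<rightarrow>\<^sub>E {-1, 0, 1}" using A by (simp add: as_trapezoid_def)
  have low: "lowest_row l c \<le> n \<longleftrightarrow> c \<in> {1 - int n..int l + int n - 1}" for c
    using trapezoid_columns[OF n] by blast
  have C01: "C j c \<in> {0, 1}" if "lowest_row l c \<le> n" "lowest_row l c \<le> Suc j" "j \<le> n" for j c
  proof -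
    have "alternating (column_entries n l A c) \<and>
        (nonzero_entries (column_entries n l A c) \<noteq> [] \<longrightarrow>
           hd (nonzero_entries (column_entries n l A c)) > 0)"
      using A that(1) unfolding low as_trapezoid_def by blast
    then show ?thesis
      using that column_condition_iff[of l c n A] PiE_mem[OF fn]
      unfolding C_def by (simp add: trapezoid_cells_iff_lowest_row)
  qed
  have col: "sum_list (column_entries n l A c) = C (lowest_row l c - 1) c" for c
    by (simp add: column_sum_eq_partial C_def)
  have central: "sum_list (column_entries n l A c) = 0" if "1 \<le> c" "c \<le> int l - 1" for c
    using A that by (simp add: as_trapezoid_def)
  \<comment> \<open>The column total is 0 or 1, so its positivity, which S prescribes for outer
    columns, determines it; for central columns it is 0 by definition of a trapezoid.\<close>
  have bottom: "C (lowest_row l c - 1) c =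
      of_bool ((c \<le> 0 \<and> c - 1 \<in> S) \<or> (c \<ge> int l \<and> c - (int l - 1) \<in> S))"
    if lc: "lowest_row l c \<le> n" for c
  proof -
    have c: "c \<in> {1 - int n..int l + int n - 1}" using lc low by blast
    have 01: "C (lowest_row l c - 1) c \<in> {0, 1}" by (rule C01) (use lc in auto)
    note S = trapezoid_set_eq_iff[OF central l, THEN iffD1, OF _ _ SA]
    consider "c \<le> 0" | "c \<ge> int l" | "0 < c" "c < int l" by linarith
    then show ?thesis
    proof cases
      case 1
      then have "c \<in> {1 - int n..0}" using c by auto
      with S have "(sum_list (column_entries n l A c) > 0) = (c - 1 \<in> S)" by blast
      then show ?thesis using 1 01 l by (auto simp: col)
    next
      case 2
      then have "c \<in> {int l..int l + int n - 1}" using c by auto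
      with S have "(sum_list (column_entries n l A c) > 0) = (c - (int l - 1) \<in> S)" by blast
      then show ?thesis using 2 01 l by (auto simp: col)
    next
      case 3
      then show ?thesis using central[of c] by (simp add: col)
    qed
  qed
  have C_Suc: "C j c = A (Suc j, c) + C (Suc j) c" if "j < n" for j c
  proof -
    have "{j<..n} = insert (Suc j) {Suc j<..n}" using that by auto
    then show ?thesis by (simp add: C_def)
  qed
  have C_Y: "C i c = of_bool ((i, c) \<in> Y)" if "lowest_row l c \<le> i" "i \<le> n" for i c
  proof (cases "i = n")
    case True
    then show ?thesis using sub by (auto simp: C_def pattern_cells_def)
  next
    case False
    then have "(i, c) \<in> pattern_cells l"
      using that by (auto simp: pattern_cells_def lowest_row_def)
    then show ?thesis using C01[of c i] that by (auto simp: Y_def)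
  qed
  have C_above: "C (i - 1) c = of_bool (above l Y i c)" if i: "lowest_row l c \<le> i" "i \<le> n" for i c
  proof (cases "lowest_row l c = i")
    case True
    then show ?thesis using bottom[of c] above_lowest_row[OF sub l, of c] i by simp
  next
    case False
    then have i': "lowest_row l c \<le> i - 1" using i by simp
    then have "above l Y i c \<longleftrightarrow> (i - 1, c) \<in> Y"
      by (auto simp: above_def lowest_row_def)
    then show ?thesis using C_Y[OF i'] i by simp
  qed
  have eq: "A = pattern_array l Y"
  proof
    fix x :: "nat \<times> int"
    obtain i c where x: "x = (i, c)" by fastforce
    show "A x = pattern_array l Y x"
    proof (cases "x \<in> trapezoid_cells n l")
      case True
      then have i: "lowest_row l c \<le> i" "i \<le> n" unfolding x trapezoid_cells_iff_lowest_row by auto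
      moreover have "i \<ge> 1" using i by (simp add: lowest_row_def)
      ultimately have "A x = C (i - 1) c - C i c" using C_Suc[of "i - 1" c] x by simp
      then show ?thesis using True C_Y[OF i] C_above[OF i] x by (simp add: pattern_array_def)
    next
      case False
      then show ?thesis using PiE_arb[OF fn False] by (simp add: pattern_array_def)
    qed
  qed
  have rows: "(\<Sum>c\<in>{- int k..int l + int k}. A (Suc k, c)) = 1 \<and>
    (\<forall>x\<in>{- int k..int l + int k}. (\<Sum>c\<in>{- int k..x}. A (Suc k, c)) \<in> {0, 1})" if k: "k < n" for k
  proof -
    have row: "sum_list (row_entries l A (Suc k)) = 1 \<and> alternating (row_entries l A (Suc k))"
      using A k by (simp add: as_trapezoid_def)
    have eqs: "1 - int (Suc k) = - int k" "int l + int (Suc k) - 1 = int l + int k" by auto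
    have "A (Suc k, c) \<in> {-1, 0, 1}" if "- int k \<le> c" "c \<le> int l + int k" for c
      by (rule PiE_mem[OF fn]) (use that k in \<open>auto simp: trapezoid_cells_def\<close>)
    from row_condition_iff[of "Suc k" l A, unfolded eqs, OF this, THEN iffD1, OF _ _ _ row]
    show ?thesis by simp
  qed
  have cards: "card {c. (i, c) \<in> Y} = height i" if "i \<le> n" for i
    using that
  proof (induction i)
    case 0
    have "{c. (0, c) \<in> Y} = {}" using sub by (auto simp: pattern_cells_def)
    then show ?case by simp
  next
    case (Suc k)
    have "count_le Y k (int l + int k) = card {c. (k, c) \<in> Y}"
      using count_le_all[OF sub, of k "int l + int k"] by simp
    moreover have "count_le Y (Suc k) (int l + int k) = card {c. (Suc k, c) \<in> Y}"
      using count_le_all[OF sub, of "Suc k" "int l + int k"] by simp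
    ultimately show ?case
      using rows[of k] pattern_array_row_sum[OF sub l, of k "int l + int k"] height_Suc[of k] Suc
      unfolding eq by (simp add: of_bool_def split: if_splits)
  qed
  have "interlacing Y"
    unfolding interlacing_def
  proof (intro allI impI)
    fix k x assume k: "k < n"
    \<comment> \<open>Interlacing concerns all thresholds, the prefix sums only the columns of row k
      + 1. To the left of that row both counts vanish; from its right end on they are the two
      heights, related by \<open>height_Suc\<close>.\<close>
    consider "x < - int k" | "x \<ge> int l + int k" | "x \<in> {- int k..int l + int k}" "x \<noteq> int l + int k"
      by fastforce
    then show "count_le Y (Suc k) x + nneg k \<le> count_le Y k x + nneg (Suc k) \<and>
     count_le Y k x + nneg (Suc k) \<le> count_le Y (Suc k) x + nneg k + 1"
    proof cases
      case 1
      then have "{c. (Suc k, c) \<in> Y \<and> c \<le> x} = {}" "{c. (k, c) \<in> Y \<and> c \<le> x} = {}"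
        using sub by (auto simp: pattern_cells_def)
      then have "count_le Y (Suc k) x = 0" "count_le Y k x = 0"
        by (simp_all only: count_le_def card.empty)
      then show ?thesis by (simp add: nneg_Suc)
    next
      case 2
      then show ?thesis
        using count_le_all[OF sub, of k x] count_le_all[OF sub, of "Suc k" x] cards[of k]
          cards[of "Suc k"] height_Suc[of k] k by (simp add: nneg_Suc of_bool_def split: if_splits)
    next
      case 3
      have "(\<Sum>c\<in>{- int k..x}. A (Suc k, c)) \<in> {0, 1}" using rows[OF k] 3 by blast
      then show ?thesis
        using pattern_array_row_sum[OF sub l k 3(1)] 3(2) nneg_Suc[of k] unfolding eq by auto
    qed
  qed
  then have "Y \<in> patterns l" using sub cards by (simp add: patterns_def)
  then show ?thesis using eq by blast
qed

text \<open>Membership of (i, c) is recovered as the sum of column c over the rows above i.\<close>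

lemma inj_on_pattern_array: "inj_on (pattern_array l) (patterns l)"
proof (rule inj_onI)
  fix Y Z assume YZ: "Y \<in> patterns l" "Z \<in> patterns l" and eq: "pattern_array l Y = pattern_array l Z"
  have sub: "Y \<subseteq> pattern_cells l" "Z \<subseteq> pattern_cells l" using YZ by (auto simp: patterns_def)
  have "(i, c) \<in> Y \<longleftrightarrow> (i, c) \<in> Z" if ic: "(i, c) \<in> pattern_cells l" for i c
  proof -
    have i: "i < n" "lowest_row l c \<le> i" using ic by (auto simp: pattern_cells_def lowest_row_def)
    have "above l W (Suc i) c \<longleftrightarrow> (i, c) \<in> W" for W
      using i by (auto simp: above_def lowest_row_def)
    then show ?thesis
      using pattern_array_column_sum[OF sub(1) i(1), of c] pattern_array_column_sum[OF sub(2) i(1), of c] i eq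
      by (simp add: of_bool_eq_iff)
  qed
  then show "Y = Z" using sub by auto
qed

lemma trapezoid_weight_eq_card_patterns:
  assumes "l \<ge> 1" "n \<ge> 1"
  shows "trapezoid_weight n l S = card (patterns l)"
proof -
  have "{A. as_trapezoid n l A \<and> trapezoid_set n l A = S} = pattern_array l ` patterns l"
    using pattern_array_as_trapezoid[OF _ assms] as_trapezoid_imp_pattern_array[OF _ _ assms] by blast
  then show ?thesis
    by (simp add: trapezoid_weight_def card_image inj_on_pattern_array)
qed

end

subsection \<open>Deleting empty central columns\<close>

lemma sum_Pow_by_card:
  fixes g :: "nat \<Rightarrow> nat"
  assumes "finite A"
  shows "(\<Sum>K\<in>Pow A. g (card K)) = (\<Sum>k\<le>card A. (card A choose k) * g k)"
proof -
  have "(\<Sum>K\<in>Pow A. g (card K)) = (\<Sum>k\<le>card A. \<Sum>K\<in>{K \<in> Pow A. card K = k}. g (card K))"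
    by (rule sum.group[symmetric]) (use assms in \<open>auto intro: card_mono\<close>)
  also have "\<dots> = (\<Sum>k\<le>card A. (card A choose k) * g k)"
    using n_subsets[OF assms] by (intro sum.cong) auto
  finally show ?thesis .
qed

text \<open>Only the last summand reaches degree N, so positivity of \<open>f N\<close> makes the
  degree exact.\<close>

lemma exists_poly_of_binomial_sum:
  fixes f :: "nat \<Rightarrow> nat"
  assumes "f N > 0"
  shows "\<exists>p :: real poly. (\<forall>m. real (\<Sum>k\<le>N. (m choose k) * f k) = poly p (real (Suc m))) \<and>
    degree p = N \<and> lead_coeff p = real (f N) / fact N"
proof -
  \<comment> \<open>This is binom(x - 1, k) as a polynomial in x, with roots 1, ..., k; the shift
    matches l = m + 1.\<close>
  define b :: "nat \<Rightarrow> real poly" where "b k = smult (1 / fact k) (\<Prod>i<k. [:- real (Suc i), 1:])" for k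
  define p where "p = (\<Sum>k\<le>N. smult (real (f k)) (b k))"
  have poly_b: "poly (b k) (real (Suc m)) = real (m choose k)" for k m
    by (simp add: b_def poly_prod binomial_gbinomial gbinomial_prod_rev atLeast0LessThan)
  have deg_prod: "degree (\<Prod>i<k. [:- real (Suc i), 1:]) = k" for k
    by (subst degree_prod_eq_sum_degree) auto
  have deg_b: "degree (b k) = k" for k
    unfolding b_def degree_smult_eq by (simp add: deg_prod del: of_nat_Suc)
  have "lead_coeff (\<Prod>i<k. [:- real (Suc i), 1:]) = 1" for k
    by (simp add: lead_coeff_prod)
  then have lead_b: "coeff (b k) k = 1 / fact k" for k
    unfolding b_def coeff_smult by (metis deg_prod mult.right_neutral)
  have coeff_N: "coeff p N = real (f N) / fact N"
  proof -
    have "coeff p N = (\<Sum>k\<le>N. real (f k) * coeff (b k) N)"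
      by (simp add: p_def coeff_sum)
    also have "\<dots> = (\<Sum>k\<le>N. if k = N then real (f N) / fact N else 0)"
      by (intro sum.cong) (auto simp: lead_b coeff_eq_0 deg_b)
    finally show ?thesis by simp
  qed
  have "degree p \<le> N"
    unfolding p_def by (rule degree_sum_le) (use deg_b in \<open>auto intro: order.trans[OF degree_smult_le]\<close>)
  moreover have "coeff p N \<noteq> 0" using assms coeff_N by simp
  ultimately have deg: "degree p = N" by (simp add: le_degree order_antisym)
  have "poly p (real (Suc m)) = real (\<Sum>k\<le>N. (m choose k) * f k)" for m
    unfolding p_def poly_sum poly_smult poly_b by (simp add: mult.commute)
  then show ?thesis using deg coeff_N by (intro exI[of _ p]) auto
qed

text \<open>Reinserts deleted columns: \<open>card K\<close> central columns are placed at the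
  positions in \<open>K\<close>, the left part of the trapezoid stays fixed and the right part moves
  outwards.\<close>

lemma strict_mono_embedding:
  fixes K :: "int set"
  assumes K: "K \<subseteq> {1..int m}"
  obtains e :: "int \<Rightarrow> int" where "strict_mono e" "\<And>c. c \<le> 0 \<Longrightarrow> e c = c"
    "\<And>c. c > int (card K) \<Longrightarrow> e c = c + (int m - int (card K))" "e ` {1..int (card K)} = K"
proof -
  have fin: "finite K" using K finite_subset by blast
  define h where "h j = sorted_list_of_set K ! j" for j
  have h: "bij_betw h {..<card K} K"
    unfolding h_def by (rule bij_betw_nth) (use fin in auto)
  have mono: "strict_mono_on {..<card K} h"
    unfolding h_def
    by (intro strict_mono_onI sorted_wrt_nth_less[OF strict_sorted_list_of_set]) (use fin in auto)
  have card_le: "card K \<le> m" using card_mono[OF _ K] by simp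
  define e where "e c = (if c \<le> 0 then c else if c \<le> int (card K) then h (nat (c - 1))
      else c + (int m - int (card K)))" for c
  have hK: "h j \<in> {1..int m}" if "j < card K" for j
    using that bij_betwE[OF h] K by blast
  have "strict_mono e"
  proof (rule strict_monoI)
    fix x y :: int assume xy: "x < y"
    consider "y \<le> 0" | "x \<le> 0" "0 < y" "y \<le> int (card K)" | "0 < x" "y \<le> int (card K)"
      | "x \<le> 0" "y > int (card K)" | "0 < x" "x \<le> int (card K)" "y > int (card K)" | "x > int (card K)"
      using xy by linarith
    then show "e x < e y"
    proof cases
      case 2
      then have "nat (y - 1) < card K" by linarith
      then show ?thesis using 2 hK[of "nat (y - 1)"] by (auto simp: e_def)
    next
      case 3
      then have "h (nat (x - 1)) < h (nat (y - 1))"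
        using xy by (intro strict_mono_onD[OF mono]) auto
      then show ?thesis using 3 xy by (auto simp: e_def)
    next
      case 5
      then have "nat (x - 1) < card K" by linarith
      then show ?thesis using 5 hK[of "nat (x - 1)"] by (auto simp: e_def)
    qed (use xy card_le in \<open>auto simp: e_def\<close>)
  qed
  moreover have "e ` {1..int (card K)} = K"
  proof -
    have "e ` {1..int (card K)} = h ` ((\<lambda>c. nat (c - 1)) ` {1..int (card K)})"
      unfolding image_image by (rule image_cong) (auto simp: e_def)
    also have "(\<lambda>c. nat (c - 1)) ` {1..int (card K)} = {..<card K}"
    proof (intro equalityI subsetI)
      fix j assume "j \<in> {..<card K}"
      then show "j \<in> (\<lambda>c. nat (c - 1)) ` {1..int (card K)}"
        by (intro image_eqI[of _ _ "int j + 1"]) auto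
    qed auto
    finally show ?thesis using h by (simp add: bij_betw_def)
  qed
  ultimately show ?thesis by (intro that[of e]) (auto simp: e_def)
qed

text \<open>Interlacing of a relabelled family has to be checked at thresholds outside the image of
  \<open>e\<close> too; each such threshold acts like some threshold \<open>z\<close> before
  relabelling.\<close>

lemma strict_mono_floor_exists:
  fixes e :: "int \<Rightarrow> int"
  assumes e: "strict_mono e" and id: "\<And>c. c \<le> 0 \<Longrightarrow> e c = c"
  obtains z where "\<And>w. e w \<le> x \<longleftrightarrow> w \<le> z"
proof -
  have ge: "w \<le> e w" for w
  proof (cases "w \<le> 0")
    case False
    then have "0 \<le> w" by simp
    then show ?thesis
    proof (induction w rule: int_ge_induct)
      case (step w)
      have "e w < e (w + 1)" using e by (simp add: strict_mono_less)
      with step show ?case by simp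
    qed (simp add: id)
  qed (simp add: id)
  \<comment> \<open>From w \<le> e w, every w with e w \<le> x is at most x, and min x 0 is fixed by
    e. So the maximum of a finite nonempty set can be taken.\<close>
  define B where "B = {w \<in> {min x 0..x}. e w \<le> x}"
  have fin: "finite B" by (rule finite_subset[of _ "{min x 0..x}"]) (auto simp: B_def)
  have "min x 0 \<in> B" using id[of "min x 0"] by (simp add: B_def)
  then have "Max B \<in> B" using fin by (intro Max_in) auto
  then have M: "e (Max B) \<le> x" "Max B \<ge> min x 0" by (auto simp: B_def)
  have "e w \<le> x \<longleftrightarrow> w \<le> Max B" for w
  proof
    assume "e w \<le> x"
    then show "w \<le> Max B"
      using ge[of w] M fin by (cases "w \<ge> min x 0") (auto simp: B_def intro: Max_ge)
  next
    assume "w \<le> Max B"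
    then have "e w \<le> e (Max B)" using e by (simp add: strict_mono_less_eq)
    then show "e w \<le> x" using M by simp
  qed
  then show ?thesis by (rule that)
qed

context catalan_set
begin

definition full_patterns :: "nat \<Rightarrow> (nat \<times> int) set set" where
  "full_patterns k = {Y \<in> patterns (k + 1). {1..int k} \<subseteq> snd ` Y}"

definition total_height :: nat where
  "total_height = (\<Sum>i\<le>n. height i)"

lemma card_pattern:
  assumes "Y \<in> patterns l"
  shows "finite Y" "card Y = total_height"
proof -
  have sub: "Y \<subseteq> pattern_cells l" and cards: "\<And>i. i \<le> n \<Longrightarrow> card {c. (i, c) \<in> Y} = height i"
    using assms by (auto simp: patterns_def)
  show "finite Y" using sub finite_pattern_cells finite_subset by blast
  have "Y = Sigma {..n} (\<lambda>i. {c. (i, c) \<in> Y})"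
    using sub by (auto simp: pattern_cells_def)
  then have "card Y = (\<Sum>i\<le>n. card {c. (i, c) \<in> Y})"
    using card_SigmaI[of "{..n}" "\<lambda>i. {c. (i, c) \<in> Y}"] finite_row[OF sub] by simp
  then show "card Y = total_height" using cards by (simp add: total_height_def)
qed

text \<open>Pigeonhole: each central column uses up at least one of the \<open>total_height\<close>
  elements.\<close>

lemma full_patterns_empty:
  assumes "k > total_height"
  shows "full_patterns k = {}"
proof (rule ccontr)
  assume "full_patterns k \<noteq> {}"
  then obtain Y where Y: "Y \<in> patterns (k + 1)" "{1..int k} \<subseteq> snd ` Y"
    by (auto simp: full_patterns_def)
  note c = card_pattern[OF Y(1)]
  have "k = card {1..int k}" by simp
  also have "\<dots> \<le> card (snd ` Y)" using Y(2) c by (intro card_mono) auto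
  also have "\<dots> \<le> card Y" using c by (intro card_image_le)
  finally show False using assms c by simp
qed

lemma row_relabel:
  "{c. (i, c) \<in> map_prod id e ` Y} = e ` {c. (i, c) \<in> Y}"
  by force

lemma count_le_relabel:
  assumes e: "strict_mono e" and z: "\<And>w. e w \<le> x \<longleftrightarrow> w \<le> z"
  shows "count_le (map_prod id e ` Y) i x = count_le Y i z"
proof -
  have "{c. (i, c) \<in> map_prod id e ` Y \<and> c \<le> x} = e ` {c. (i, c) \<in> Y \<and> c \<le> z}"
    using z by force
  moreover have "inj_on e X" for X using e strict_mono_imp_inj_on by (metis inj_on_subset subset_UNIV)
  ultimately show ?thesis unfolding count_le_def by (simp add: card_image)
qed

text \<open>For i \<ge> 1 the left end 1 - i of row i is fixed by e and the right end k + i is sent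
  to m + i, so rows correspond to rows; counts are preserved by monotonicity.\<close>

lemma relabel_in_patterns_iff:
  assumes e: "strict_mono e" and id: "\<And>c. c \<le> 0 \<Longrightarrow> e c = c"
    and sh: "\<And>c. c > int k \<Longrightarrow> e c = c + (int m - int k)"
  shows "map_prod id e ` Y \<in> patterns (m + 1) \<longleftrightarrow> Y \<in> patterns (k + 1)"
proof -
  have inj: "inj_on e X" for X using e strict_mono_imp_inj_on by (metis inj_on_subset subset_UNIV)
  have cells: "(i, e c) \<in> pattern_cells (m + 1) \<longleftrightarrow> (i, c) \<in> pattern_cells (k + 1)" for i c
  proof (cases "i \<ge> 1")
    case True
    have "1 - int i \<le> e c \<longleftrightarrow> 1 - int i \<le> c"
      using strict_mono_less_eq[OF e, of "1 - int i" c] id[of "1 - int i"] True by simp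
    moreover have "e c \<le> int m + int i \<longleftrightarrow> c \<le> int k + int i"
      using strict_mono_less_eq[OF e, of c "int k + int i"] sh[of "int k + int i"] True
      by (simp add: add.commute)
    ultimately show ?thesis by (auto simp: pattern_cells_def)
  qed (simp add: pattern_cells_def)
  have "interlacing (map_prod id e ` Y) \<longleftrightarrow> interlacing Y"
  proof
    assume H: "interlacing (map_prod id e ` Y)"
    have "count_le (map_prod id e ` Y) i (e x) = count_le Y i x" for i x
      by (rule count_le_relabel[OF e]) (simp add: strict_mono_less_eq[OF e])
    then show "interlacing Y" using H unfolding interlacing_def by metis
  next
    assume H: "interlacing Y"
    \<comment> \<open>The same z has to serve for all rows i, since interlacing compares two rows at
      one threshold.\<close>
    have "\<exists>z. \<forall>i. count_le (map_prod id e ` Y) i x = count_le Y i z" for x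
      using strict_mono_floor_exists[OF e id, of x] count_le_relabel[OF e, of x] by metis
    then show "interlacing (map_prod id e ` Y)" using H unfolding interlacing_def by metis
  qed
  moreover have "map_prod id e ` Y \<subseteq> pattern_cells (m + 1) \<longleftrightarrow> Y \<subseteq> pattern_cells (k + 1)"
    using cells by force
  moreover have "card {c. (i, c) \<in> map_prod id e ` Y} = card {c. (i, c) \<in> Y}" for i
    unfolding row_relabel by (rule card_image[OF inj])
  ultimately show ?thesis unfolding patterns_def by simp
qed

text \<open>Here the empty central columns are deleted: with prescribed nonempty central columns
  \<open>K\<close>, only the size of \<open>K\<close> matters.\<close>

lemma card_patterns_with_columns:
  assumes K: "K \<subseteq> {1..int m}"
  shows "card {Y \<in> patterns (m + 1). snd ` Y \<inter> {1..int m} = K} = card (full_patterns (card K))"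
proof -
  define k where "k = card K"
  obtain e where e: "strict_mono e" and id: "\<And>c. c \<le> 0 \<Longrightarrow> e c = c"
    and sh: "\<And>c. c > int k \<Longrightarrow> e c = c + (int m - int k)" and img: "e ` {1..int k} = K"
    using strict_mono_embedding[OF K] unfolding k_def by blast
  note pat = relabel_in_patterns_iff[OF e id sh]
  let ?r = "\<lambda>Y. map_prod id e ` Y :: (nat \<times> int) set"
  have inj: "inj e" using e strict_mono_imp_inj_on by blast
  have mid: "e c \<in> {1..int m} \<longleftrightarrow> c \<in> {1..int k}" for c
  proof -
    have "1 \<le> e c \<longleftrightarrow> 1 \<le> c" using strict_mono_less[OF e, of 0 c] id[of 0] by auto
    moreover have "e c \<le> int m \<longleftrightarrow> c \<le> int k"
      using strict_mono_less[OF e, of c "int k + 1"] sh[of "int k + 1"] by auto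
    ultimately show ?thesis by simp
  qed
  have cols: "snd ` ?r Y \<inter> {1..int m} = e ` (snd ` Y \<inter> {1..int k})" for Y
  proof -
    have "snd ` ?r Y = e ` snd ` Y" by (simp add: image_image)
    moreover have "e ` X \<inter> {1..int m} = e ` (X \<inter> {1..int k})" for X
    proof (intro set_eqI iffI)
      fix d assume "d \<in> e ` X \<inter> {1..int m}"
      then obtain c where "c \<in> X" "d = e c" "e c \<in> {1..int m}" by blast
      then show "d \<in> e ` (X \<inter> {1..int k})" using mid[of c] by blast
    next
      fix d assume "d \<in> e ` (X \<inter> {1..int k})"
      then obtain c where "c \<in> X" "d = e c" "c \<in> {1..int k}" by blast
      then show "d \<in> e ` X \<inter> {1..int m}" using mid[of c] by blast
    qed
    ultimately show ?thesis by simp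
  qed
  have cols_iff: "snd ` ?r Y \<inter> {1..int m} = K \<longleftrightarrow> {1..int k} \<subseteq> snd ` Y" for Y
    unfolding cols img[symmetric] inj_image_eq_iff[OF inj] by blast
  \<comment> \<open>The map e misses only the central columns outside \<open>K\<close>, and these
    are empty in the patterns considered. Hence every such pattern is an image.\<close>
  have range: "c \<in> range e" if "c \<notin> {1..int m} \<or> c \<in> K" for c
  proof -
    have "c \<le> 0 \<or> c > int m \<or> c \<in> K" using that by auto
    then consider "c \<le> 0" | "c > int m" | "c \<in> K" by blast
    then show ?thesis
    proof cases
      case 1
      then show ?thesis using id[of c] by (metis rangeI)
    next
      case 2
      then have "c = e (c - (int m - int k))" using sh[of "c - (int m - int k)"] by simp
      then show ?thesis by blast
    next
      case 3
      then show ?thesis using img by blast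
    qed
  qed
  have "?r ` full_patterns k = {Y \<in> patterns (m + 1). snd ` Y \<inter> {1..int m} = K}"
  proof (intro equalityI subsetI)
    fix Y assume "Y \<in> ?r ` full_patterns k"
    then obtain Z where Z: "Y = ?r Z" "Z \<in> patterns (k + 1)" "{1..int k} \<subseteq> snd ` Z"
      unfolding full_patterns_def by blast
    then show "Y \<in> {Y \<in> patterns (m + 1). snd ` Y \<inter> {1..int m} = K}"
      using pat[of Z] cols_iff[of Z] by simp
  next
    fix Y assume Y: "Y \<in> {Y \<in> patterns (m + 1). snd ` Y \<inter> {1..int m} = K}"
    have "c \<in> range e" if "(i, c) \<in> Y" for i c
    proof (rule range)
      have "c \<in> snd ` Y" using that by force
      then show "c \<notin> {1..int m} \<or> c \<in> K" using Y by blast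
    qed
    have "Y \<subseteq> range (map_prod id e)"
    proof (rule subrelI)
      fix i c assume "(i, c) \<in> Y"
      then obtain d where "c = e d" using \<open>\<And>i c. (i, c) \<in> Y \<Longrightarrow> c \<in> range e\<close> by blast
      then have "(i, c) = map_prod id e (i, d)" by simp
      then show "(i, c) \<in> range (map_prod id e)" by (rule range_eqI)
    qed
    then have "?r (map_prod id e -` Y) = Y" unfolding image_vimage_eq by blast
    moreover from this have "map_prod id e -` Y \<in> full_patterns k"
      using Y pat[of "map_prod id e -` Y"] cols_iff[of "map_prod id e -` Y"]
      by (simp add: full_patterns_def)
    ultimately show "Y \<in> ?r ` full_patterns k" by (metis imageI)
  qed
  moreover have "inj_on ?r (full_patterns k)"
  proof -
    have "inj (map_prod id e :: nat \<times> int \<Rightarrow> nat \<times> int)" using inj by (intro prod.inj_map) auto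
    then show ?thesis by (auto intro!: inj_onI simp: inj_image_eq_iff)
  qed
  ultimately show ?thesis unfolding k_def[symmetric] by (metis card_image)
qed

lemma card_patterns_eq_binomial_sum:
  "card (patterns (m + 1)) = (\<Sum>k\<le>total_height. (m choose k) * card (full_patterns k))"
proof -
  let ?cols = "\<lambda>Y :: (nat \<times> int) set. snd ` Y \<inter> {1..int m}"
  have "card (patterns (m + 1)) = (\<Sum>Y\<in>patterns (m + 1). 1)" by simp
  also have "\<dots> = (\<Sum>K\<in>Pow {1..int m}. \<Sum>Y\<in>{Y \<in> patterns (m + 1). ?cols Y = K}. 1)"
    by (rule sum.group[symmetric]) (use finite_patterns in auto)
  also have "\<dots> = (\<Sum>K\<in>Pow {1..int m}. card (full_patterns (card K)))"
    by (rule sum.cong) (use card_patterns_with_columns in auto)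
  also have "\<dots> = (\<Sum>k\<le>m. (m choose k) * card (full_patterns k))"
    using sum_Pow_by_card[of "{1..int m}" "\<lambda>k. card (full_patterns k)"] by simp
  \<comment> \<open>Beyond m the binomial coefficients vanish, beyond \<open>total_height\<close>
    the full patterns do; passing through the maximum makes the range independent of m.\<close>
  also have "\<dots> = (\<Sum>k\<le>max m total_height. (m choose k) * card (full_patterns k))"
    by (rule sum.mono_neutral_left) auto
  also have "\<dots> = (\<Sum>k\<le>total_height. (m choose k) * card (full_patterns k))"
    by (rule sum.mono_neutral_right) (auto simp: full_patterns_empty)
  finally show ?thesis .
qed

end

subsection \<open>Skew tableaux read along diagonals\<close>

text \<open>Replaces the sorted list behind the s_i by counting functions, which is how
  \<open>npos\<close> and \<open>nneg\<close> enter the description of the diagrams.\<close>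

lemma nth_sorted_list_of_set_le_iff:
  fixes B :: "int set"
  assumes fin: "finite B" and j: "j < card B"
  shows "sorted_list_of_set B ! j \<le> x \<longleftrightarrow> j < card {b \<in> B. b \<le> x}"
proof -
  define xs where "xs = sorted_list_of_set B"
  have xs: "length xs = card B" "set xs = B" "sorted xs" "distinct xs"
    using fin by (auto simp: xs_def)
  have inj: "inj_on ((!) xs) {..<card B}" using xs by (auto simp: inj_on_def nth_eq_iff_index_eq)
  show ?thesis unfolding xs_def[symmetric]
  proof
    assume le: "xs ! j \<le> x"
    have "(!) xs ` {..j} \<subseteq> {b \<in> B. b \<le> x}"
    proof
      fix b assume "b \<in> (!) xs ` {..j}"
      then obtain k where k: "k \<le> j" "b = xs ! k" by auto
      then have "b \<le> xs ! j" using xs j by (auto intro: sorted_nth_mono)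
      moreover have "b \<in> set xs" using k xs j by auto
      ultimately show "b \<in> {b \<in> B. b \<le> x}" using le xs by auto
    qed
    then have "card ((!) xs ` {..j}) \<le> card {b \<in> B. b \<le> x}" using fin by (intro card_mono) auto
    moreover have "inj_on ((!) xs) {..j}" by (rule inj_on_subset[OF inj]) (use j in auto)
    then have "card ((!) xs ` {..j}) = Suc j" by (simp add: card_image)
    ultimately show "j < card {b \<in> B. b \<le> x}" by simp
  next
    assume lt: "j < card {b \<in> B. b \<le> x}"
    show "xs ! j \<le> x"
    proof (rule ccontr)
      assume gt: "\<not> xs ! j \<le> x"
      have "{b \<in> B. b \<le> x} \<subseteq> (!) xs ` {..<j}"
      proof
        fix b assume b: "b \<in> {b \<in> B. b \<le> x}"
        then obtain k where k: "k < card B" "b = xs ! k" using xs by (auto simp: in_set_conv_nth)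
        have "k < j"
        proof (rule ccontr)
          assume "\<not> k < j"
          then have "xs ! j \<le> xs ! k" using xs k by (intro sorted_nth_mono) auto
          then show False using gt b k by auto
        qed
        then show "b \<in> (!) xs ` {..<j}" using k by auto
      qed
      then have "card {b \<in> B. b \<le> x} \<le> card ((!) xs ` {..<j})" by (intro card_mono) auto
      also have "\<dots> \<le> j" using card_image_le[of "{..<j}" "(!) xs"] by simp
      finally show False using lt by simp
    qed
  qed
qed

text \<open>Numbering the cells row by row is standard. \<open>M\<close> exceeds every column index,
  so \<open>code\<close> orders cells lexicographically. This makes the leading coefficient
  nonzero.\<close>

lemma standard_tableaux_nonempty:
  assumes "finite D"
  shows "standard_tableaux D \<noteq> {}"
proof -
  define M where "M = Suc (Max (snd ` D))"
  have M: "j < M" if "(i, j) \<in> D" for i j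
  proof -
    have "j \<in> snd ` D" using that by force
    then show ?thesis using assms by (simp add: M_def less_Suc_eq_le)
  qed
  define code where "code = (\<lambda>(i, j). i * M + j)"
  define T where "T = (\<lambda>x\<in>D. card {y \<in> D. code y \<le> code x})"
  have code_less: "code (i, j) < code (i', j')" if "i < i'" "(i, j) \<in> D" for i j i' j'
  proof -
    have "i * M + j < Suc i * M" using M[OF that(2)] by simp
    also have "\<dots> \<le> i' * M" using that(1) by (intro mult_right_mono) auto
    finally show ?thesis by (simp add: code_def)
  qed
  have mono: "T x < T y" if "x \<in> D" "y \<in> D" "code x < code y" for x y
  proof -
    have "{z \<in> D. code z \<le> code x} \<subseteq> {z \<in> D. code z \<le> code y}"
      "y \<in> {z \<in> D. code z \<le> code y}" "y \<notin> {z \<in> D. code z \<le> code x}"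
      using that by auto
    then have "{z \<in> D. code z \<le> code x} \<subset> {z \<in> D. code z \<le> code y}" by blast
    then show ?thesis using that assms by (auto simp: T_def intro: psubset_card_mono)
  qed
  have inj_code: "inj_on code D"
  proof (rule inj_onI)
    fix x y assume xy: "x \<in> D" "y \<in> D" "code x = code y"
    obtain i j i' j' where "x = (i, j)" "y = (i', j')" by fastforce
    then show "x = y" using xy code_less[of i i' j j'] code_less[of i' i j' j]
      by (cases i i' rule: linorder_cases) (auto simp: code_def)
  qed
  have inj: "inj_on T D"
    using mono inj_code by (metis inj_onI inj_onD linorder_neq_iff)
  have "T ` D \<subseteq> {1..card D}"
  proof
    fix t assume "t \<in> T ` D"
    then obtain x where x: "x \<in> D" "t = card {y \<in> D. code y \<le> code x}" by (auto simp: T_def)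
    have "{y \<in> D. code y \<le> code x} \<noteq> {}" using x by blast
    then have "0 < t" using x assms by (simp add: card_gt_0_iff)
    moreover have "t \<le> card D" unfolding x(2) using assms by (intro card_mono) auto
    ultimately show "t \<in> {1..card D}" by simp
  qed
  then have "T ` D = {1..card D}"
    using inj by (intro card_subset_eq) (auto simp: card_image)
  with inj have "bij_betw T D {1..card D}" by (simp add: bij_betw_def)
  moreover have "T \<in> extensional D" by (simp add: T_def)
  moreover have "code (i, j) < code (i, j')" if "j < j'" for i j j'
    using that by (simp add: code_def)
  ultimately have "T \<in> standard_tableaux D"
    unfolding standard_tableaux_def using code_less by (auto intro!: mono)
  then show ?thesis by blast
qed

context catalan_set
begin

section \<open>The skew shape in terms of the counting functions\<close>

lemma num_neg_eq: "num_neg S = nneg n"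
  unfolding num_neg_def nneg_def by (rule arg_cong[of _ _ card]) (use S_subset in auto)

lemma npos_le_npos_n: "npos i \<le> npos n"
  unfolding npos_def using finite_S S_subset by (intro card_mono) auto

lemma nneg_le_nneg_n: "nneg i \<le> nneg n"
  unfolding nneg_def using finite_S S_subset by (intro card_mono) auto

lemma card_nonzero: "card (S - {0}) = n"
  using catalan zero_in_S finite_S by (simp add: centred_catalan_set_def)

text \<open>With c counted from 0, s_{u+1+c} is the positive element that has exactly c positive
  elements below it.\<close>

lemma positive_elem_le_iff:
  assumes "c < npos n"
  shows "nonzero_elem S (nneg n + 1 + c) \<le> int i \<longleftrightarrow> c < npos i"
proof -
  have "{b \<in> S - {0}. b \<le> int i} = {s \<in> S. s < 0} \<union> {s \<in> S. 0 < s \<and> s \<le> int i}" by auto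
  then have "card {b \<in> S - {0}. b \<le> int i} = nneg n + npos i"
    unfolding num_neg_eq[symmetric] num_neg_def npos_def using finite_S
    by (simp add: card_Un_disjoint disjoint_iff)
  then show ?thesis
    using nth_sorted_list_of_set_le_iff[of "S - {0}" "nneg n + c" "int i"] assms finite_S card_nonzero npos_nneg_n
    by (simp add: nonzero_elem_def)
qed

text \<open>Exactly r elements precede s_{r+1}, so it is at least -i iff at most r of the negative
  elements are below -i.\<close>

lemma negative_elem_ge_iff:
  assumes "r < nneg n"
  shows "- nonzero_elem S (r + 1) \<le> int i \<longleftrightarrow> nneg n \<le> r + nneg i"
proof -
  have "{s \<in> S. s < 0} = {b \<in> S - {0}. b \<le> - int i - 1} \<union> {s \<in> S. - int i \<le> s \<and> s < 0}" by auto
  then have "card {s \<in> S. s < 0} = card {b \<in> S - {0}. b \<le> - int i - 1} + nneg i"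
    unfolding nneg_def using finite_S by (simp add: card_Un_disjoint disjoint_iff)
  then have "nneg n = card {b \<in> S - {0}. b \<le> - int i - 1} + nneg i"
    by (simp only: num_neg_def num_neg_eq[symmetric])
  moreover have "sorted_list_of_set (S - {0}) ! r \<le> - int i - 1 \<longleftrightarrow> r < card {b \<in> S - {0}. b \<le> - int i - 1}"
    by (rule nth_sorted_list_of_set_le_iff) (use assms finite_S card_nonzero npos_nneg_n in auto)
  ultimately show ?thesis by (auto simp: nonzero_elem_def)
qed

text \<open>Column c of lambda has length u + 1 + c - s_{u+1+c} and row r of mu has length -s_{r+1}
  - (u - r). Solving both inequalities for the element of S leaves the same bound i = u + c - r:
  s_{u+1+c} \<le> i for being in lambda, -s_{r+1} \<le> i for being outside mu.\<close>

lemma skew_shape_iff: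
  "(r, c) \<in> skew_shape n S \<longleftrightarrow>
     r < nneg n \<and> c < npos (nneg n + c - r) \<and> nneg n \<le> r + nneg (nneg n + c - r)"
proof -
  let ?u = "nneg n"
  let ?i = "?u + c - r"
  have lam: "(r, c) \<in> lambda_diagram n S \<longleftrightarrow>
      c < npos n \<and> int r < int (?u + 1 + c) - nonzero_elem S (?u + 1 + c)"
    using npos_nneg_n
    by (auto simp: lambda_diagram_def conjugate_diagram_def young_diagram_def num_neg_eq
        simp del: upt_Suc)
  have mu: "(r, c) \<in> mu_diagram S \<longleftrightarrow> r < ?u \<and> int c < - nonzero_elem S (r + 1) - (int ?u - int r)"
    by (auto simp: mu_diagram_def young_diagram_def num_neg_eq simp del: upt_Suc)
  have lam': "(r, c) \<in> lambda_diagram n S \<longleftrightarrow> r < ?u \<and> c < npos ?i"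
  proof
    assume L: "(r, c) \<in> lambda_diagram n S"
    then have c: "c < npos n" by (simp add: lam)
    \<comment> \<open>Needed before the truncated difference u + c - r can be read as an integer: a
      positive element exceeds 0, hence r < u + c. The sharper r < u then comes from c <
      \<open>npos\<close> i \<le> i.\<close>
    have "\<not> nonzero_elem S (?u + 1 + c) \<le> int 0" unfolding positive_elem_le_iff[OF c] by simp
    then have "r < ?u + c" using L unfolding lam by linarith
    then have "int ?i = int ?u + int c - int r" by simp
    then have "nonzero_elem S (?u + 1 + c) \<le> int ?i" using L unfolding lam by linarith
    then have "c < npos ?i" using positive_elem_le_iff[OF c] by blast
    moreover have "npos ?i \<le> ?i" by (rule npos_le)
    ultimately show "r < ?u \<and> c < npos ?i" by linarith
  next
    assume R: "r < ?u \<and> c < npos ?i"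
    then have c: "c < npos n" using npos_le_npos_n[of ?i] by linarith
    then have "nonzero_elem S (?u + 1 + c) \<le> int ?i" using positive_elem_le_iff[OF c] R by blast
    moreover have "int ?i = int ?u + int c - int r" using R by simp
    ultimately show "(r, c) \<in> lambda_diagram n S" using c unfolding lam by linarith
  qed
  have "(r, c) \<notin> mu_diagram S \<longleftrightarrow> ?u \<le> r + nneg ?i" if r: "r < ?u"
  proof -
    have "int ?i = int ?u + int c - int r" using r by simp
    then have "(r, c) \<notin> mu_diagram S \<longleftrightarrow> - nonzero_elem S (r + 1) \<le> int ?i"
      using r unfolding mu by linarith
    then show ?thesis using negative_elem_ge_iff[OF r] by simp
  qed
  then show ?thesis using lam' by (auto simp: skew_shape_def)
qed

definition diagonal :: "nat \<times> nat \<Rightarrow> nat" where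
  "diagonal x = nneg n + snd x - fst x"

text \<open>The cells of diagonal i outside mu start in row u - \<open>nneg\<close> i; this is the
  distance from that row.\<close>

definition diagonal_index :: "nat \<times> nat \<Rightarrow> nat" where
  "diagonal_index x = fst x + nneg (diagonal x) - nneg n"

text \<open>The inverse of the pair (\<open>diagonal\<close>, \<open>diagonal_index\<close>); for j
  = 0 it is the starting position of diagonal i.\<close>

definition diagonal_cell :: "nat \<Rightarrow> nat \<Rightarrow> nat \<times> nat" where
  "diagonal_cell i j = (nneg n - nneg i + j, i - nneg i + j)"

lemma skew_shapeD:
  assumes "x \<in> skew_shape n S"
  shows "fst x < nneg n" "snd x < npos (diagonal x)" "nneg n \<le> fst x + nneg (diagonal x)"
    "1 \<le> diagonal x" "diagonal x < n" "diagonal_index x < height (diagonal x)"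
    "diagonal x + fst x = nneg n + snd x" "diagonal_index x + nneg n = fst x + nneg (diagonal x)"
proof -
  obtain r c where x: "x = (r, c)" by fastforce
  show 1: "fst x < nneg n" and 2: "snd x < npos (diagonal x)"
    and 3: "nneg n \<le> fst x + nneg (diagonal x)"
    using assms skew_shape_iff[of r c] unfolding x diagonal_def by auto
  show "1 \<le> diagonal x" using 1 by (simp add: diagonal_def)
  show 7: "diagonal x + fst x = nneg n + snd x" using 1 by (simp add: diagonal_def)
  show 5: "diagonal x < n"
    using 2 7 npos_le_npos_n[of "diagonal x"] npos_nneg_n by linarith
  show 8: "diagonal_index x + nneg n = fst x + nneg (diagonal x)"
    using 3 by (simp add: diagonal_index_def)
  show "diagonal_index x < height (diagonal x)"
    using 8 7 2 height_add[of "diagonal x"] 5 by linarith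
qed

lemma skew_shape_iff_diagonal:
  "x \<in> skew_shape n S \<longleftrightarrow>
     fst x < nneg n \<and> snd x < npos (diagonal x) \<and> nneg n \<le> fst x + nneg (diagonal x)"
  using skew_shape_iff[of "fst x" "snd x"] by (simp add: diagonal_def)

lemma diagonal_cell_in_skew_shape:
  assumes "i \<le> n" "j < height i"
  shows "diagonal_cell i j \<in> skew_shape n S" "diagonal (diagonal_cell i j) = i"
    "diagonal_index (diagonal_cell i j) = j"
proof -
  have le: "nneg i \<le> nneg n" "nneg i \<le> i" "npos i \<le> i"
    using nneg_le_nneg_n nneg_le npos_le by auto
  have h: "height i + i = npos i + nneg i" using height_add assms by simp
  show d: "diagonal (diagonal_cell i j) = i"
    using le by (simp add: diagonal_def diagonal_cell_def)
  show "diagonal_index (diagonal_cell i j) = j"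
    unfolding diagonal_index_def d using le by (simp add: diagonal_cell_def)
  \<comment> \<open>The column bound is j < \<open>height\<close> i; the row bound follows from it
    because \<open>npos\<close> i \<le> i.\<close>
  show "diagonal_cell i j \<in> skew_shape n S"
    unfolding skew_shape_iff_diagonal d using le h assms by (auto simp: diagonal_cell_def)
qed

lemma diagonal_cell_diagonal:
  assumes "x \<in> skew_shape n S"
  shows "diagonal_cell (diagonal x) (diagonal_index x) = x"
proof -
  note D = skew_shapeD[OF assms]
  have "nneg (diagonal x) \<le> nneg n" "nneg (diagonal x) \<le> diagonal x"
    using nneg_le_nneg_n nneg_le by auto
  then have "nneg n - nneg (diagonal x) + diagonal_index x = fst x"
    "diagonal x - nneg (diagonal x) + diagonal_index x = snd x"
    using D by linarith+
  then show ?thesis by (simp add: diagonal_cell_def)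
qed

lemma bij_betw_diagonal_index:
  assumes "i \<le> n"
  shows "bij_betw diagonal_index {x \<in> skew_shape n S. diagonal x = i} {..<height i}"
  by (rule bij_betw_byWitness[where f' = "diagonal_cell i"])
    (use assms skew_shapeD diagonal_cell_in_skew_shape diagonal_cell_diagonal in auto)

lemma finite_skew_shape: "finite (skew_shape n S)"
proof -
  have "x \<in> {..<nneg n} \<times> {..<npos n}" if "x \<in> skew_shape n S" for x
    using skew_shapeD(1,2)[OF that] npos_le_npos_n[of "diagonal x"] by (cases x) auto
  then show ?thesis by (meson finite_SigmaI finite_lessThan finite_subset subsetI)
qed

lemma card_diagonal: "i \<le> n \<Longrightarrow> card {x \<in> skew_shape n S. diagonal x = i} = height i"
  using bij_betw_same_card[OF bij_betw_diagonal_index] by simp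

lemma card_skew_shape: "card (skew_shape n S) = total_height"
proof -
  have "card (skew_shape n S) = (\<Sum>x\<in>skew_shape n S. 1)" by simp
  also have "\<dots> = (\<Sum>i\<le>n. \<Sum>x\<in>{x \<in> skew_shape n S. diagonal x = i}. 1)"
    by (rule sum.group[symmetric])
      (use finite_skew_shape skew_shapeD(5) in \<open>auto simp: less_imp_le\<close>)
  also have "\<dots> = total_height"
    unfolding total_height_def by (rule sum.cong) (auto simp: card_diagonal)
  finally show ?thesis .
qed

lemma standard_tableauD:
  assumes "T \<in> standard_tableaux (skew_shape n S)"
  shows "bij_betw T (skew_shape n S) {1..total_height}"
    "\<And>r c c'. (r, c) \<in> skew_shape n S \<Longrightarrow> (r, c') \<in> skew_shape n S \<Longrightarrow> c < c' \<Longrightarrow> T (r, c) < T (r, c')"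
    "\<And>r r' c. (r, c) \<in> skew_shape n S \<Longrightarrow> (r', c) \<in> skew_shape n S \<Longrightarrow> r < r' \<Longrightarrow> T (r, c) < T (r', c)"
    "T \<in> extensional (skew_shape n S)"
  using assms unfolding standard_tableaux_def card_skew_shape by blast+

lemma tableau_less_on_diagonal:
  assumes T: "T \<in> standard_tableaux (skew_shape n S)"
    and x: "x \<in> skew_shape n S" and y: "y \<in> skew_shape n S"
    and d: "diagonal x = diagonal y" and less: "diagonal_index x < diagonal_index y"
  shows "T x < T y"
proof -
  note X = skew_shapeD[OF x] and Y = skew_shapeD[OF y]
  have r: "fst x < fst y" using X(8) Y(8) d less by simp
  have c: "snd x < snd y" using X(7) Y(7) d r by linarith
  \<comment> \<open>The corner to the right of x and above y. It belongs to the shape because its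
    diagonal is at least that of x and y and the counting functions are monotone.\<close>
  let ?z = "(fst x, snd y)"
  have "diagonal y \<le> diagonal ?z" using r by (simp add: diagonal_def)
  then have "npos (diagonal y) \<le> npos (diagonal ?z)" "nneg (diagonal y) \<le> nneg (diagonal ?z)"
    using npos_mono nneg_mono by auto
  then have z: "?z \<in> skew_shape n S"
    unfolding skew_shape_iff_diagonal using X(1,3) Y(2) d by auto
  have "T x < T ?z" using standard_tableauD(2)[OF T, of "fst x" "snd x" "snd y"] x z c by simp
  also have "T ?z < T y" using standard_tableauD(3)[OF T, of "fst x" "snd y" "fst y"] y z r by simp
  finally show ?thesis .
qed

section \<open>From tableaux to patterns\<close>

definition tableau_pattern :: "(nat \<times> nat \<Rightarrow> nat) \<Rightarrow> (nat \<times> int) set" where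
  "tableau_pattern T = (\<lambda>x. (diagonal x, int (T x))) ` skew_shape n S"

lemma count_le_tableau_pattern:
  assumes "inj_on T (skew_shape n S)"
  shows "count_le (tableau_pattern T) i a = card {x \<in> skew_shape n S. diagonal x = i \<and> int (T x) \<le> a}"
proof -
  have "{c. (i, c) \<in> tableau_pattern T \<and> c \<le> a} =
      (\<lambda>x. int (T x)) ` {x \<in> skew_shape n S. diagonal x = i \<and> int (T x) \<le> a}"
    by (auto simp: tableau_pattern_def)
  moreover have "inj_on (\<lambda>x. int (T x)) {x \<in> skew_shape n S. diagonal x = i \<and> int (T x) \<le> a}"
    using assms by (auto simp: inj_on_def)
  ultimately show ?thesis by (simp add: count_le_def card_image)
qed

text \<open>Entries increase along a diagonal, so the position of an entry there is its rank. This
  is what makes the tableau recoverable from its pattern.\<close>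

lemma count_below_tableau_entry:
  assumes T: "T \<in> standard_tableaux (skew_shape n S)" and x: "x \<in> skew_shape n S"
  shows "count_le (tableau_pattern T) (diagonal x) (int (T x) - 1) = diagonal_index x"
proof -
  let ?D = "{y \<in> skew_shape n S. diagonal y = diagonal x}"
  have bij: "bij_betw diagonal_index ?D {..<height (diagonal x)}"
    using bij_betw_diagonal_index skew_shapeD(5)[OF x] by simp
  have inj: "inj_on T (skew_shape n S)" using standard_tableauD(1)[OF T] by (simp add: bij_betw_def)
  have iff: "int (T y) \<le> int (T x) - 1 \<longleftrightarrow> diagonal_index y < diagonal_index x" if "y \<in> ?D" for y
    using that x tableau_less_on_diagonal[OF T, of x y] tableau_less_on_diagonal[OF T, of y x]
      inj_onD[OF bij_betw_imp_inj_on[OF bij], of x y]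
    by (cases "diagonal_index x" "diagonal_index y" rule: linorder_cases) auto
  have "count_le (tableau_pattern T) (diagonal x) (int (T x) - 1) =
      card {y \<in> ?D. diagonal_index y < diagonal_index x}"
    unfolding count_le_tableau_pattern[OF inj] by (rule arg_cong[of _ _ card]) (use iff in auto)
  also have "\<dots> = card (diagonal_index ` {y \<in> ?D. diagonal_index y < diagonal_index x})"
    by (rule card_image[symmetric], rule inj_on_subset[OF bij_betw_imp_inj_on[OF bij]]) auto
  also have "diagonal_index ` {y \<in> ?D. diagonal_index y < diagonal_index x} = {..<diagonal_index x}"
  proof -
    have "diagonal_index ` {y \<in> ?D. diagonal_index y < diagonal_index x} =
        diagonal_index ` ?D \<inter> {..<diagonal_index x}" by auto
    also have "\<dots> = {..<height (diagonal x)} \<inter> {..<diagonal_index x}"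
      using bij by (simp add: bij_betw_def)
    also have "\<dots> = {..<diagonal_index x}" using skew_shapeD(6)[OF x] by auto
    finally show ?thesis .
  qed
  finally show ?thesis by simp
qed

text \<open>Left neighbours map diagonal i + 1 to diagonal i, upper neighbours map diagonal i to
  diagonal i + 1, and both carry smaller entries. Each map fails for at most the first cell of its
  diagonal: the former only if -(i + 1) is in S, the latter only if it is not.\<close>

lemma interlacing_tableau_pattern:
  assumes T: "T \<in> standard_tableaux (skew_shape n S)"
  shows "interlacing (tableau_pattern T)"
  unfolding interlacing_def
proof (intro allI impI)
  fix i a assume i: "i < n"
  let ?D = "skew_shape n S"
  have inj: "inj_on T ?D" using standard_tableauD(1)[OF T] by (simp add: bij_betw_def)
  note cnt = count_le_tableau_pattern[OF inj]
  define E where "E i = {x \<in> ?D. diagonal x = i \<and> int (T x) \<le> a}" for i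
  have finE: "finite (E i)" for i using finite_skew_shape by (simp add: E_def)
  have step: "nneg (Suc i) = nneg i \<or> nneg (Suc i) = Suc (nneg i)"
    "npos (Suc i) \<le> Suc (npos i)" "npos i \<le> npos (Suc i)"
    by (auto simp: nneg_Suc npos_Suc)
  have len: "nneg (Suc i) \<le> nneg n" "nneg i \<le> i"
    using nneg_le_nneg_n nneg_le by auto
  \<comment> \<open>The cells whose left neighbour lies in mu.\<close>
  let ?B = "{x \<in> E (Suc i). fst x + nneg i < nneg n}"
  have "E (Suc i) \<subseteq> (\<lambda>(r, c). (r, Suc c)) ` E i \<union> ?B"
  proof
    fix x assume x: "x \<in> E (Suc i)"
    then have xD: "x \<in> ?D" and d: "diagonal x = Suc i" and le: "int (T x) \<le> a" by (auto simp: E_def)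
    note X = skew_shapeD[OF xD, unfolded d]
    show "x \<in> (\<lambda>(r, c). (r, Suc c)) ` E i \<union> ?B"
    proof (cases "fst x + nneg i < nneg n")
      case False
      have "snd x \<noteq> 0" using False X(7) len by linarith
      then obtain c where c: "snd x = Suc c" using not0_implies_Suc by blast
      let ?y = "(fst x, c)"
      have dy: "diagonal ?y = i" using X(7) c by (simp add: diagonal_def)
      have yD: "?y \<in> ?D" unfolding skew_shape_iff_diagonal dy using False X c step by auto
      have "T ?y < T x" using standard_tableauD(2)[OF T yD, of "Suc c"] xD c by (metis lessI prod.collapse)
      then have "?y \<in> E i" using dy yD le by (simp add: E_def)
      moreover have "x = (\<lambda>(r, c). (r, Suc c)) ?y" using c by (simp add: prod_eq_iff)
      ultimately show ?thesis by blast
    qed (use x in auto)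
  qed
  then have "card (E (Suc i)) \<le> card ((\<lambda>(r, c). (r, Suc c)) ` E i \<union> ?B)"
    using finE by (intro card_mono) auto
  also have "\<dots> \<le> card (E i) + card ?B"
    by (rule order.trans[OF card_Un_le]) (use finE in \<open>auto intro: card_image_le\<close>)
  also have "card ?B \<le> nneg (Suc i) - nneg i"
  proof -
    have B: "fst x = nneg n - nneg (Suc i) \<and> nneg (Suc i) = Suc (nneg i) \<and> snd x = Suc i - nneg (Suc i)"
      if "x \<in> ?B" for x
    proof -
      have xD: "x \<in> ?D" and d: "diagonal x = Suc i" using that by (auto simp: E_def)
      show ?thesis using skew_shapeD[OF xD, unfolded d] that step by auto
    qed
    have "?B \<subseteq> (if nneg (Suc i) = Suc (nneg i) then {(nneg n - nneg (Suc i), Suc i - nneg (Suc i))} else {})"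
    proof
      fix x assume "x \<in> ?B"
      from B[OF this] show "x \<in> (if nneg (Suc i) = Suc (nneg i) then {(nneg n - nneg (Suc i), Suc i - nneg (Suc i))} else {})"
        by (simp add: prod_eq_iff)
    qed
    then have "card ?B \<le> card (if nneg (Suc i) = Suc (nneg i) then {(nneg n - nneg (Suc i), Suc i - nneg (Suc i))} else {})"
      by (rule card_mono[rotated]) simp
    then show ?thesis by (auto split: if_splits)
  qed
  finally have 1: "card (E (Suc i)) + nneg i \<le> card (E i) + nneg (Suc i)" using step by auto
  \<comment> \<open>The cells with no upper neighbour in the shape, being next to mu or in the top
    row.\<close>
  let ?C = "{x \<in> E i. fst x + nneg (Suc i) \<le> nneg n}"
  have "E i \<subseteq> (\<lambda>(r, c). (Suc r, c)) ` E (Suc i) \<union> ?C"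
  proof
    fix x assume x: "x \<in> E i"
    then have xD: "x \<in> ?D" and d: "diagonal x = i" and le: "int (T x) \<le> a" by (auto simp: E_def)
    note X = skew_shapeD[OF xD, unfolded d]
    show "x \<in> (\<lambda>(r, c). (Suc r, c)) ` E (Suc i) \<union> ?C"
    proof (cases "fst x + nneg (Suc i) \<le> nneg n")
      case False
      have "fst x \<noteq> 0" using False len by linarith
      then obtain r where r: "fst x = Suc r" using not0_implies_Suc by blast
      let ?y = "(r, snd x)"
      have dy: "diagonal ?y = Suc i" using X(7,1) r by (simp add: diagonal_def)
      have yD: "?y \<in> ?D" unfolding skew_shape_iff_diagonal dy using False X r step by auto
      have "T ?y < T x" using standard_tableauD(3)[OF T yD, of "Suc r"] xD r by (metis lessI prod.collapse)
      then have "?y \<in> E (Suc i)" using dy yD le by (simp add: E_def)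
      moreover have "x = (\<lambda>(r, c). (Suc r, c)) ?y" using r by (simp add: prod_eq_iff)
      ultimately show ?thesis by blast
    qed (use x in auto)
  qed
  then have "card (E i) \<le> card ((\<lambda>(r, c). (Suc r, c)) ` E (Suc i) \<union> ?C)"
    using finE by (intro card_mono) auto
  also have "\<dots> \<le> card (E (Suc i)) + card ?C"
    by (rule order.trans[OF card_Un_le]) (use finE in \<open>auto intro: card_image_le\<close>)
  also have "card ?C \<le> Suc (nneg i) - nneg (Suc i)"
  proof -
    have C: "fst x = nneg n - nneg i \<and> nneg (Suc i) = nneg i \<and> snd x = i - nneg i" if "x \<in> ?C" for x
    proof -
      have xD: "x \<in> ?D" and d: "diagonal x = i" using that by (auto simp: E_def)
      show ?thesis using skew_shapeD[OF xD, unfolded d] that step by auto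
    qed
    have "?C \<subseteq> (if nneg (Suc i) = nneg i then {(nneg n - nneg i, i - nneg i)} else {})"
    proof
      fix x assume "x \<in> ?C"
      from C[OF this] show "x \<in> (if nneg (Suc i) = nneg i then {(nneg n - nneg i, i - nneg i)} else {})"
        by (simp add: prod_eq_iff)
    qed
    then have "card ?C \<le> card (if nneg (Suc i) = nneg i then {(nneg n - nneg i, i - nneg i)} else {})"
      by (rule card_mono[rotated]) simp
    then show ?thesis by (auto split: if_splits)
  qed
  finally have 2: "card (E i) + nneg (Suc i) \<le> card (E (Suc i)) + nneg i + 1" using step by auto
  show "count_le (tableau_pattern T) (Suc i) a + nneg i \<le> count_le (tableau_pattern T) i a + nneg (Suc i) \<and>
     count_le (tableau_pattern T) i a + nneg (Suc i) \<le> count_le (tableau_pattern T) (Suc i) a + nneg i + 1"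
    unfolding cnt using 1 2 by (simp add: E_def)
qed

lemma tableau_pattern_in_full_patterns:
  assumes T: "T \<in> standard_tableaux (skew_shape n S)"
  shows "tableau_pattern T \<in> full_patterns total_height"
proof -
  let ?D = "skew_shape n S"
  have bij: "bij_betw T ?D {1..total_height}" using standard_tableauD(1)[OF T] .
  have rng: "1 \<le> T x \<and> T x \<le> total_height" if "x \<in> ?D" for x
    using bij_betwE[OF bij] that by auto
  have "tableau_pattern T \<subseteq> pattern_cells (total_height + 1)"
  proof
    fix p assume "p \<in> tableau_pattern T"
    then obtain x where x: "x \<in> ?D" "p = (diagonal x, int (T x))" by (auto simp: tableau_pattern_def)
    then show "p \<in> pattern_cells (total_height + 1)"
      using skew_shapeD(4,5)[OF x(1)] rng[OF x(1)] by (auto simp: pattern_cells_def)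
  qed
  moreover have "card {c. (i, c) \<in> tableau_pattern T} = height i" if "i \<le> n" for i
  proof -
    have "{c. (i, c) \<in> tableau_pattern T} = (\<lambda>x. int (T x)) ` {x \<in> ?D. diagonal x = i}"
      by (auto simp: tableau_pattern_def)
    moreover have "inj_on (\<lambda>x. int (T x)) {x \<in> ?D. diagonal x = i}"
      using bij by (auto simp: bij_betw_def inj_on_def)
    ultimately show ?thesis using card_diagonal[OF that] by (simp add: card_image)
  qed
  moreover have "{1..int total_height} \<subseteq> snd ` tableau_pattern T"
  proof
    fix c assume c: "c \<in> {1..int total_height}"
    then have "nat c \<in> {1..total_height}" by auto
    then obtain x where x: "x \<in> ?D" "T x = nat c" using bij by (metis bij_betw_def imageE)
    then have "(diagonal x, c) \<in> tableau_pattern T" using c by (force simp: tableau_pattern_def)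
    then show "c \<in> snd ` tableau_pattern T" by force
  qed
  ultimately show ?thesis
    using interlacing_tableau_pattern[OF T] by (simp add: full_patterns_def patterns_def)
qed

section \<open>Recovering the tableau from its pattern\<close>

lemma count_le_less:
  assumes Y: "Y \<subseteq> pattern_cells l" and "(i, c) \<in> Y" "a < c" "c \<le> b"
  shows "count_le Y i a < count_le Y i b"
  unfolding count_le_def
proof (rule psubset_card_mono)
  show "finite {c. (i, c) \<in> Y \<and> c \<le> b}"
    by (rule finite_subset[OF _ finite_row[OF Y, of i]]) auto
  show "{c. (i, c) \<in> Y \<and> c \<le> a} \<subset> {c. (i, c) \<in> Y \<and> c \<le> b}"
    using assms by force
qed

lemma inj_on_tableau_pattern: "inj_on tableau_pattern (standard_tableaux (skew_shape n S))"
proof (rule inj_onI)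
  fix T U assume T: "T \<in> standard_tableaux (skew_shape n S)" and U: "U \<in> standard_tableaux (skew_shape n S)"
    and eq: "tableau_pattern T = tableau_pattern U"
  have le: "V x \<le> W x"
    if V: "V \<in> standard_tableaux (skew_shape n S)" and W: "W \<in> standard_tableaux (skew_shape n S)"
      and VW: "tableau_pattern V = tableau_pattern W" and x: "x \<in> skew_shape n S" for V W x
  proof (rule ccontr)
    assume "\<not> V x \<le> W x"
    \<comment> \<open>The element \<open>W x\<close> would be counted below \<open>V x\<close> but
      not below itself, although both counts are \<open>diagonal_index x\<close>.\<close>
    then have "count_le (tableau_pattern W) (diagonal x) (int (W x) - 1) <
        count_le (tableau_pattern W) (diagonal x) (int (V x) - 1)"
      using tableau_pattern_in_full_patterns[OF W] x
      by (intro count_le_less[of _ _ _ "int (W x)"])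
        (auto simp: full_patterns_def patterns_def tableau_pattern_def)
    then show False
      using count_below_tableau_entry[OF V x] count_below_tableau_entry[OF W x] VW by simp
  qed
  show "T = U"
  proof (rule extensionalityI)
    show "T \<in> extensional (skew_shape n S)" "U \<in> extensional (skew_shape n S)"
      using T U standard_tableauD(4) by auto
    show "T x = U x" if "x \<in> skew_shape n S" for x
      using le[OF T U eq that] le[OF U T eq[symmetric] that] by simp
  qed
qed

text \<open>Interlacing summed over several rows, so that two cells of one row (first claim) or one
  column (second claim) can be compared without passing through the cells between them.\<close>

lemma interlacing_upward:
  assumes il: "interlacing Y" and ij: "i \<le> j" "j \<le> n"
  shows "count_le Y j a + nneg i \<le> count_le Y i a + nneg j"
    "count_le Y i a + nneg j + i \<le> count_le Y j a + nneg i + j"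
proof -
  have "j \<le> n \<longrightarrow> count_le Y j a + nneg i \<le> count_le Y i a + nneg j \<and>
      count_le Y i a + nneg j + i \<le> count_le Y j a + nneg i + j"
    using ij(1)
  proof (induction rule: dec_induct)
    case (step k)
    show ?case
    proof
      assume k: "Suc k \<le> n"
      then have "count_le Y (Suc k) a + nneg k \<le> count_le Y k a + nneg (Suc k)"
        "count_le Y k a + nneg (Suc k) \<le> count_le Y (Suc k) a + nneg k + 1"
        using il by (auto simp: interlacing_def)
      then show "count_le Y (Suc k) a + nneg i \<le> count_le Y i a + nneg (Suc k) \<and>
        count_le Y i a + nneg (Suc k) + i \<le> count_le Y (Suc k) a + nneg i + Suc k"
        using step.IH k by linarith
    qed
  qed simp
  then show "count_le Y j a + nneg i \<le> count_le Y i a + nneg j"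
    "count_le Y i a + nneg j + i \<le> count_le Y j a + nneg i + j"
    using ij(2) by auto
qed

lemma full_pattern_imp_tableau_pattern:
  assumes Y: "Y \<in> full_patterns total_height"
  shows "\<exists>T\<in>standard_tableaux (skew_shape n S). tableau_pattern T = Y"
proof -
  let ?D = "skew_shape n S" and ?N = total_height
  have pat: "Y \<in> patterns (?N + 1)" and full: "{1..int ?N} \<subseteq> snd ` Y"
    using Y by (auto simp: full_patterns_def)
  have sub: "Y \<subseteq> pattern_cells (?N + 1)" and cards: "\<And>i. i \<le> n \<Longrightarrow> card {c. (i, c) \<in> Y} = height i"
    and il: "interlacing Y"
    using pat by (auto simp: patterns_def)
  have fin: "finite Y" and cardY: "card Y = ?N" using card_pattern[OF pat] by auto
  \<comment> \<open>All N central columns are hit and \<open>Y\<close> has only N elements. So no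
    other column occurs and none occurs twice.\<close>
  have sndY: "snd ` Y = {1..int ?N}"
    using card_seteq[of "snd ` Y" "{1..int ?N}"] full fin card_image_le[OF fin, of snd] cardY by simp
  have inj_snd: "inj_on snd Y"
    by (rule eq_card_imp_inj_on[OF fin]) (simp add: sndY cardY)
  \<comment> \<open>An element of Y_i goes to the cell of diagonal i whose position is its rank in
    Y_i; being injective between sets of equal size, g is onto the shape.\<close>
  define g where "g = (\<lambda>(i, c). diagonal_cell i (count_le Y i (c - 1)))"
  have g: "g (i, c) \<in> ?D" "diagonal (g (i, c)) = i" "diagonal_index (g (i, c)) = count_le Y i (c - 1)"
    if ic: "(i, c) \<in> Y" for i c
  proof -
    have i: "i \<le> n" using ic sub by (auto simp: pattern_cells_def)
    have "count_le Y i (c - 1) < card {c. (i, c) \<in> Y}"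
      unfolding count_le_def using ic by (intro psubset_card_mono finite_row[OF sub]) auto
    then have "count_le Y i (c - 1) < height i" using cards[OF i] by simp
    from diagonal_cell_in_skew_shape[OF i this]
    show "g (i, c) \<in> ?D" "diagonal (g (i, c)) = i" "diagonal_index (g (i, c)) = count_le Y i (c - 1)"
      by (simp_all add: g_def)
  qed
  have inj_g: "inj_on g Y"
  proof (rule inj_onI)
    fix p q assume p: "p \<in> Y" and q: "q \<in> Y" and eq: "g p = g q"
    obtain i c j d where pq: "p = (i, c)" "q = (j, d)" by fastforce
    have ij: "i = j" using g(2) p q eq unfolding pq by metis
    have cnt: "count_le Y i (c - 1) = count_le Y i (d - 1)" using g(3) p q eq ij unfolding pq by metis
    have "\<not> c < d" using count_le_less[OF sub, of i c "c - 1" "d - 1"] p cnt pq by auto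
    moreover have "\<not> d < c" using count_le_less[OF sub, of i d "d - 1" "c - 1"] q cnt pq ij by auto
    ultimately show "p = q" using pq ij by simp
  qed
  have "g ` Y \<subseteq> ?D" using g(1) by auto
  then have gY: "g ` Y = ?D"
    using finite_skew_shape inj_g by (intro card_subset_eq) (auto simp: card_image cardY card_skew_shape)
  define T where "T = (\<lambda>x\<in>?D. nat (snd (inv_into Y g x)))"
  have T: "(diagonal x, int (T x)) \<in> Y \<and> diagonal_index x = count_le Y (diagonal x) (int (T x) - 1)"
    if x: "x \<in> ?D" for x
  proof -
    obtain i c where ic: "(i, c) \<in> Y" "x = g (i, c)" using x gY by (metis imageE prod.collapse)
    then have inv: "inv_into Y g x = (i, c)" using inj_g by (simp add: inv_into_f_f)
    have "c \<in> {1..int ?N}" using ic(1) sndY by force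
    then have "int (T x) = c" using x inv by (simp add: T_def)
    then show ?thesis using g[OF ic(1)] ic by simp
  qed
  have injT: "inj_on T ?D"
  proof (rule inj_onI)
    fix x y assume x: "x \<in> ?D" and y: "y \<in> ?D" and eq: "T x = T y"
    have "diagonal x = diagonal y"
      using inj_onD[OF inj_snd, of "(diagonal x, int (T x))" "(diagonal y, int (T y))"] T[OF x] T[OF y] eq by simp
    moreover from this have "diagonal_index x = diagonal_index y" using T[OF x] T[OF y] eq by metis
    ultimately show "x = y" using diagonal_cell_diagonal[OF x] diagonal_cell_diagonal[OF y] by metis
  qed
  have "T ` ?D \<subseteq> {1..?N}"
  proof
    fix t assume "t \<in> T ` ?D"
    then obtain x where x: "x \<in> ?D" "t = T x" by auto
    then have "int t \<in> snd ` Y" using T[OF x(1)] by force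
    then show "t \<in> {1..?N}" unfolding sndY by auto
  qed
  then have "T ` ?D = {1..?N}"
    using injT by (intro card_subset_eq) (auto simp: card_image card_skew_shape)
  with injT have bijT: "bij_betw T ?D {1..?N}" by (simp add: bij_betw_def)
  \<comment> \<open>\<open>T x\<close> has rank \<open>diagonal_index x\<close> on its diagonal, so
    it is at most any threshold with more elements than that below or at it. Injectivity makes the
    inequality strict.\<close>
  have less: "T x < T y"
    if x: "x \<in> ?D" and y: "y \<in> ?D" and ne: "x \<noteq> y"
      and cnt: "diagonal_index x < count_le Y (diagonal x) (int (T y))" for x y
  proof (rule ccontr)
    assume "\<not> T x < T y"
    then have "T y < T x" using injT x y ne by (metis inj_onD linorder_neqE_nat)
    then have "count_le Y (diagonal x) (int (T y)) \<le> count_le Y (diagonal x) (int (T x) - 1)"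
      unfolding count_le_def
      by (intro card_mono finite_subset[OF _ finite_row[OF sub, of "diagonal x"]]) auto
    then show False using cnt T[OF x] by simp
  qed
  have self: "diagonal_index y < count_le Y (diagonal y) (int (T y))" if y: "y \<in> ?D" for y
    using count_le_less[OF sub, of "diagonal y" "int (T y)" "int (T y) - 1" "int (T y)"] T[OF y] by simp
  have row: "T (r, c) < T (r, c')"
    if x: "(r, c) \<in> ?D" and y: "(r, c') \<in> ?D" and cc: "c < c'" for r c c'
  proof (rule less[OF x y])
    let ?i = "diagonal (r, c)" and ?j = "diagonal (r, c')"
    note X = skew_shapeD[OF x] and Y = skew_shapeD[OF y]
    have "?i \<le> ?j" "?j \<le> n" using cc Y(5) by (auto simp: diagonal_def)
    \<comment> \<open>Within a row the positions on two diagonals differ by the difference of their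
      \<open>nneg\<close> values, exactly the loss allowed by the first claim.\<close>
    from interlacing_upward(1)[OF il this, of "int (T (r, c'))"]
    show "diagonal_index (r, c) < count_le Y ?i (int (T (r, c')))"
      using self[OF y] X(8) Y(8) by simp
  qed (use cc in auto)
  have col: "T (r, c) < T (r', c)"
    if x: "(r, c) \<in> ?D" and y: "(r', c) \<in> ?D" and rr: "r < r'" for r r' c
  proof (rule less[OF x y])
    let ?i = "diagonal (r, c)" and ?j = "diagonal (r', c)"
    note X = skew_shapeD[OF x] and Y = skew_shapeD[OF y]
    have "?j \<le> ?i" "?i \<le> n" using rr X(5) by (auto simp: diagonal_def)
    \<comment> \<open>Within a column r' - r is the difference of the diagonals, which accounts for
      the additional terms of the second claim.\<close>
    from interlacing_upward(2)[OF il this, of "int (T (r', c))"]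
    show "diagonal_index (r, c) < count_le Y ?i (int (T (r', c)))"
      using self[OF y] X(7,8) Y(7,8) by simp
  qed (use rr in auto)
  have "T \<in> standard_tableaux ?D"
    unfolding standard_tableaux_def card_skew_shape using bijT row col by (auto simp: T_def)
  moreover have "tableau_pattern T = Y"
  proof (rule card_subset_eq[OF fin])
    show "tableau_pattern T \<subseteq> Y" using T by (auto simp: tableau_pattern_def)
    have "inj_on (\<lambda>x. (diagonal x, int (T x))) ?D" using injT by (auto simp: inj_on_def)
    then show "card (tableau_pattern T) = card Y"
      by (simp add: tableau_pattern_def card_image card_skew_shape cardY)
  qed
  ultimately show ?thesis by blast
qed

lemma card_full_patterns: "card (full_patterns total_height) = card (standard_tableaux (skew_shape n S))"
proof -
  have "full_patterns total_height = tableau_pattern ` standard_tableaux (skew_shape n S)"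
    using tableau_pattern_in_full_patterns full_pattern_imp_tableau_pattern by blast
  then show ?thesis by (simp add: card_image inj_on_tableau_pattern)
qed

lemma card_standard_tableaux_pos: "card (standard_tableaux (skew_shape n S)) > 0"
proof -
  have "finite (tableau_pattern ` standard_tableaux (skew_shape n S))"
    by (rule finite_subset[OF _ finite_patterns[of "total_height + 1"]])
      (use tableau_pattern_in_full_patterns in \<open>auto simp: full_patterns_def\<close>)
  then have "finite (standard_tableaux (skew_shape n S))"
    using inj_on_tableau_pattern by (rule finite_imageD)
  then show ?thesis
    using standard_tableaux_nonempty[OF finite_skew_shape] by (simp add: card_gt_0_iff)
qed

end

subsection \<open>The area under the Motzkin path\<close>

lemma has_integral_affine:
  fixes a b m :: real
  shows "((\<lambda>x. b + (x - a) * m) has_integral (b + m / 2)) {a..a + 1}"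
proof -
  have "((\<lambda>x. b + (x - a) * m) has_integral
      ((b * (a + 1) + m * (a + 1 - a)\<^sup>2 / 2) - (b * a + m * (a - a)\<^sup>2 / 2))) {a..a + 1}"
    by (rule fundamental_theorem_of_calculus)
      (auto intro!: derivative_eq_intros simp: has_real_derivative_iff_has_vector_derivative[symmetric])
  then show ?thesis by (simp add: algebra_simps)
qed

lemma path_height_measurable: "path_height ms \<in> borel_measurable borel"
proof -
  have "(\<lambda>x. (\<lambda>k x. real_of_int (sum_list (take k ms)) +
      (x - real k) * (if k < length ms then real_of_int (ms ! k) else 0)) (nat \<lfloor>x\<rfloor>) x) \<in> borel_measurable borel"
    \<comment> \<open>Countably many affine pieces are glued along the measurable index
      \<open>nat \<lfloor>x\<rfloor>\<close>.\<close>
    by (rule measurable_compose_countable) measurable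
  then show ?thesis by (simp add: path_height_def[abs_def] Let_def)
qed

text \<open>By continuity the formula of a piece extends to its right end, where the definition
  already uses the next piece. Integration over closed intervals needs this.\<close>

lemma path_height_between:
  assumes k: "k < length ms" and x: "real k \<le> x" "x \<le> real k + 1"
  shows "path_height ms x = real_of_int (sum_list (take k ms)) + (x - real k) * real_of_int (ms ! k)"
proof (cases "x = real k + 1")
  case True
  then have "nat \<lfloor>x\<rfloor> = Suc k" by linarith
  then show ?thesis using True k by (simp add: path_height_def take_Suc_conv_app_nth)
next
  case False
  then have "nat \<lfloor>x\<rfloor> = k" using x by linarith
  then show ?thesis using k by (simp add: path_height_def)
qed

lemma path_height_has_integral:
  assumes "k \<le> length ms"
  shows "(path_height ms has_integral
    (\<Sum>j<k. real_of_int (sum_list (take j ms)) + real_of_int (ms ! j) / 2)) {0..real k}"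
  using assms
proof (induction k)
  case 0
  show ?case by (simp add: has_integral_refl)
next
  case (Suc k)
  have "(path_height ms has_integral (real_of_int (sum_list (take k ms)) + real_of_int (ms ! k) / 2))
      {real k..real k + 1}"
    by (rule has_integral_eq[OF _ has_integral_affine])
      (use Suc.prems path_height_between[of k ms] in auto)
  with Suc have "(path_height ms has_integral
      ((\<Sum>j<k. real_of_int (sum_list (take j ms)) + real_of_int (ms ! j) / 2) +
       (real_of_int (sum_list (take k ms)) + real_of_int (ms ! k) / 2))) {0..real k + 1}"
    by (intro has_integral_combine[of 0 "real k"]) auto
  then show ?case by (simp add: add.commute)
qed

text \<open>Cavalieri: the vertical slice over x is the interval from 0 to
  \<open>path_height ms x\<close>, and the slice lengths are integrated.\<close>

lemma path_area_eq_integral: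
  assumes I: "(path_height ms has_integral I) {0..real (length ms)}"
    and nonneg: "\<And>x. 0 \<le> x \<Longrightarrow> x \<le> real (length ms) \<Longrightarrow> 0 \<le> path_height ms x"
  shows "path_area ms = I"
proof -
  let ?R = "{(x, y). 0 \<le> x \<and> x \<le> real (length ms) \<and> 0 \<le> y \<and> y \<le> path_height ms x}"
  note [measurable] = path_height_measurable
  have "{p \<in> space (borel \<Otimes>\<^sub>M borel). 0 \<le> fst p \<and> fst p \<le> real (length ms) \<and> (0 :: real) \<le> snd p \<and>
      snd p \<le> path_height ms (fst p)} \<in> sets (borel \<Otimes>\<^sub>M borel)"
    by measurable
  also have "{p \<in> space (borel \<Otimes>\<^sub>M borel). 0 \<le> fst p \<and> fst p \<le> real (length ms) \<and> (0 :: real) \<le> snd p \<and>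
      snd p \<le> path_height ms (fst p)} = ?R"
    by (auto simp: space_pair_measure)
  finally have "?R \<in> sets (lborel \<Otimes>\<^sub>M lborel)" by (simp cong: sets_pair_measure_cong)
  then have "emeasure (lborel \<Otimes>\<^sub>M lborel) ?R = (\<integral>\<^sup>+x. emeasure lborel (Pair x -` ?R) \<partial>lborel)"
    by (rule lborel.emeasure_pair_measure_alt)
  also have "\<dots> = (\<integral>\<^sup>+x. ennreal (path_height ms x) * indicator {0..real (length ms)} x \<partial>lborel)"
  proof (rule nn_integral_cong)
    fix x :: real
    show "emeasure lborel (Pair x -` ?R) = ennreal (path_height ms x) * indicator {0..real (length ms)} x"
    proof (cases "0 \<le> x \<and> x \<le> real (length ms)")
      case True
      then have "Pair x -` ?R = {0..path_height ms x}" by auto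
      then show ?thesis using True nonneg[of x] by simp
    next
      case False
      then have "Pair x -` ?R = {}" by auto
      then show ?thesis using False by auto
    qed
  qed
  also have "\<dots> = ennreal I"
    by (rule nn_integral_has_integral_lebesgue'[OF _ I]) (use nonneg in auto)
  finally have "emeasure lborel ?R = ennreal I" by (simp add: lborel_prod)
  moreover have "0 \<le> I" using has_integral_nonneg[OF I] nonneg by auto
  ultimately show ?thesis by (simp add: path_area_def measure_def)
qed

context catalan_set
begin

lemma length_motzkin_steps: "length (motzkin_steps n S) = n"
  by (simp add: motzkin_steps_def)

lemma motzkin_steps_nth:
  assumes "k < n"
  shows "motzkin_steps n S ! k = int (height (Suc k)) - int (height k)"
proof -
  have "{- int (Suc k), int (Suc k)} \<inter> S =
      (if - int (Suc k) \<in> S then {- int (Suc k)} else {}) \<union> (if int (Suc k) \<in> S then {int (Suc k)} else {})"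
    by auto
  then have "card ({- int (Suc k), int (Suc k)} \<inter> S) =
      of_bool (int (Suc k) \<in> S) + of_bool (- int (Suc k) \<in> S)"
    by simp
  moreover have "motzkin_steps n S ! k = int (card ({- int (Suc k), int (Suc k)} \<inter> S)) - 1"
    using assms by (simp add: motzkin_steps_def nth_append del: upt_Suc)
  ultimately show ?thesis using height_Suc[OF assms] by linarith
qed

lemma sum_motzkin_steps:
  "k \<le> n \<Longrightarrow> sum_list (take k (motzkin_steps n S)) = int (height k)"
proof (induction k)
  case (Suc k)
  then show ?case
    by (simp add: take_Suc_conv_app_nth length_motzkin_steps motzkin_steps_nth)
qed simp

lemma path_area_motzkin_steps: "path_area (motzkin_steps n S) = real total_height"
proof -
  let ?ms = "motzkin_steps n S"
  have nonneg: "0 \<le> path_height ?ms x" if x: "0 \<le> x" "x \<le> real (length ?ms)" for x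
  proof (cases "x = real n")
    case True
    moreover have "sum_list ?ms = 0" using sum_motzkin_steps[of n] by (simp add: length_motzkin_steps)
    ultimately show ?thesis by (simp add: path_height_def length_motzkin_steps)
  next
    case False
    define k where "k = nat \<lfloor>x\<rfloor>"
    have k: "k < n" "real k \<le> x" "x \<le> real k + 1"
      using x False unfolding k_def length_motzkin_steps by linarith+
    \<comment> \<open>On a unit interval the path is a convex combination of two heights, which are
      natural numbers.\<close>
    have "path_height ?ms x = (1 - (x - real k)) * real (height k) + (x - real k) * real (height (Suc k))"
      using k by (simp add: path_height_between length_motzkin_steps sum_motzkin_steps
          motzkin_steps_nth algebra_simps)
    then show ?thesis using k by simp
  qed
  have "(\<Sum>j<n. real_of_int (sum_list (take j ?ms)) + real_of_int (?ms ! j) / 2) =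
      (\<Sum>j<n. (real (height j) + real (height (Suc j))) / 2)"
    by (rule sum.cong) (auto simp: sum_motzkin_steps motzkin_steps_nth field_simps)
  also have "\<dots> = ((\<Sum>j<n. real (height j)) + (\<Sum>j<n. real (height (Suc j)))) / 2"
    by (simp add: sum.distrib flip: sum_divide_distrib)
  \<comment> \<open>The shift changes the sum by the difference of the two end heights, both 0. So
    the halves from the trapezoid rule add up to the sum of all heights.\<close>
  also have "(\<Sum>j<n. real (height (Suc j))) = (\<Sum>j<n. real (height j))"
    using sum.lessThan_Suc_shift[of "\<lambda>j. real (height j)" n] by simp
  also have "(\<Sum>j<n. real (height j)) = real total_height"
    by (simp add: total_height_def lessThan_Suc_atMost[symmetric])
  finally have "(path_height ?ms has_integral real total_height) {0..real (length ?ms)}"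
    using path_height_has_integral[of n ?ms] by (simp add: length_motzkin_steps)
  then show ?thesis by (rule path_area_eq_integral) (use nonneg in auto)
qed

end

subsection \<open>Polynomiality of the weight\<close>

theorem theorem1p2:
  fixes n :: nat and S :: "int set"
  assumes "n \<ge> 1"
    and "centred_catalan_set (n + 1) S"
  shows "real (card (skew_shape n S)) = path_area (motzkin_steps n S) \<and>
    (\<exists>p :: real poly.
       (\<forall>l\<ge>1. real (trapezoid_weight n l S) = poly p (real l)) \<and>
       degree p = card (skew_shape n S) \<and>
       lead_coeff p = real (card (standard_tableaux (skew_shape n S))) / fact (card (skew_shape n S)))"
proof -
  interpret catalan_set n S by unfold_locales (fact assms(2))
  have "card (full_patterns total_height) > 0"
    using card_full_patterns card_standard_tableaux_pos by simp
  from exists_poly_of_binomial_sum[of "\<lambda>k. card (full_patterns k)", OF this]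
  obtain p :: "real poly" where
    p: "\<And>m. real (\<Sum>k\<le>total_height. (m choose k) * card (full_patterns k)) = poly p (real (Suc m))"
    and deg: "degree p = total_height"
    and lead: "lead_coeff p = real (card (full_patterns total_height)) / fact total_height"
    by blast
  have "real (trapezoid_weight n l S) = poly p (real l)" if l: "l \<ge> 1" for l
  proof -
    obtain m where m: "l = Suc m" using l by (cases l) auto
    then show ?thesis
      using trapezoid_weight_eq_card_patterns[OF l assms(1)] card_patterns_eq_binomial_sum[of m] p[of m]
      by simp
  qed
  then show ?thesis
    using deg lead path_area_motzkin_steps unfolding card_skew_shape card_full_patterns by auto
qed

end
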